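(* Let $n \ge 1$ be an integer and let $\epsilon > 0$. There exists a constant $C = C(n,\epsilon) > 0$, depending only on $n$ and $\epsilon$, such that the following holds. Let $f(x) = \alpha_n x^n + \dots + \alpha_1 x + \alpha_0$ be a polynomial of degree $n$ with real coefficients, let $\delta, X \in \mathbb{R}$ satisfy $0 \le \delta \le 1/4$ and $X \ge 2$, and let $$\Gamma_{\delta} := \{(x,y) \in \mathbb{R}^2 :\ x \in [X,2X],\ |y-f(x)| \le \delta\}, \qquad \mathcal{S} := \#(\Gamma_{\delta} \cap \mathbb{Z}^2).$$ Assume that the inequality $$\left|\alpha_n-\frac{r}{s}\right| \le \frac{1}{s^2}$$ holds for some integers $r \in \mathbb{Z}$ and $s \in [1,X^n]$ with $\gcd(r,s)=1$. Then $$\mathcal{S} \le C\left(\delta^{\frac{2}{n(n+1)}}X+\frac{X}{s^{1/n}}+X^{\epsilon}\right).$$ Moreover, for $n = 1$ the third term $X^{\epsilon}$ can be replaced by $1$ (that is, for $n=1$ one has $\mathcal{S} \le C'\left(\delta X + \frac{X}{s} + 1\right)$ with an absolute constant $C'>0$). *)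

theory Defs
  imports Complex_Main "HOL-Computational_Algebra.Polynomial"
begin

definition curve_nbhd :: "real poly \<Rightarrow> real \<Rightarrow> real \<Rightarrow> (real \<times> real) set" where
  "curve_nbhd f \<delta> X = {(x, y). x \<in> {X..2 * X} \<and> \<bar>y - poly f x\<bar> \<le> \<delta>}"

definition lattice_count :: "real poly \<Rightarrow> real \<Rightarrow> real \<Rightarrow> nat" where
  "lattice_count f \<delta> X = card (curve_nbhd f \<delta> X \<inter> \<int> \<times> \<int>)"

text \<open>The set counted above is finite, so \<^const>\<open>card\<close> gives its true number of elements.\<close>

lemma finite_curve_nbhd_lattice: "finite (curve_nbhd f \<delta> X \<inter> \<int> \<times> \<int>)"
proof (rule finite_subset)
  let ?A = "\<lambda>a b :: real. of_int ` {\<lceil>a\<rceil>..\<lfloor>b\<rfloor>} :: real set"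
  show "finite (Sigma (?A X (2 * X)) (\<lambda>x. ?A (poly f x - \<delta>) (poly f x + \<delta>)))"
    by auto
  show "curve_nbhd f \<delta> X \<inter> \<int> \<times> \<int> \<subseteq> Sigma (?A X (2 * X)) (\<lambda>x. ?A (poly f x - \<delta>) (poly f x + \<delta>))"
    by (force simp: curve_nbhd_def abs_le_iff ceiling_le_iff le_floor_iff elim!: Ints_cases)
qed

end

theory Submission
  imports Defs "HOL-Computational_Algebra.Primes"
begin

text \<open>
  Attach to every abscissa \<open>x\<close> of a lattice point in question its ordinate \<open>y x\<close>, an integer at distance
  at most \<open>\<delta>\<close> from \<open>f x\<close>. Let \<open>L\<close> be a small constant times \<open>\<delta> powr (- 2 / (n * (n + 1)))\<close>. If \<open>n + 2\<close> of
  the points have abscissae in an interval of length \<open>L\<close>, the determinant with rows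
  \<open>(1, x, \<dots>, x ^ n, y x)\<close> is an integer of absolute value less than 1, so they lie on a common curve
  \<open>y = P x\<close> with \<open>degree P \<le> n\<close> (\<open>near_points_lie_on_lagrange\<close>). An interval of length \<open>L\<close> with
  boundedly many points is harmless, since there are at most \<open>X / L + 1\<close> of these. What has to be bounded
  are long runs of consecutive points on one curve \<open>P\<close>.

  The tool for this is the common denominator \<open>Q\<close> of the coefficients of \<open>P\<close>. Lagrange's formula shows
  that for any \<open>n + 1\<close> points of the run \<open>Q\<close> divides the least common multiple of the products of
  differences \<open>\<Prod>y\<in>X - {x}. x - y\<close> (\<open>denominator_exists\<close>). If \<open>p ^ k\<close> is the exact power of a prime
  \<open>p\<close> in \<open>Q\<close>, it follows that the points occupy at most \<open>n\<close> residue classes modulo a power of \<open>p\<close> of size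
  about \<open>p powr (k / n)\<close>. Combining the primes, at most \<open>C * h / Q powr (1 / n) + n ^ \<omega>(Q)\<close> points of
  the run lie in an interval of length \<open>h\<close>, where \<open>\<omega>(Q)\<close> is the number of prime divisors
  (\<open>card_le_density\<close>). Moreover, \<open>n\<^sup>2 + 1\<close> points in an interval of length \<open>B\<close> force \<open>Q\<close> to be smaller than
  \<open>B powr (n * (n + 1) / 2)\<close> by a power of \<open>B\<close>, if \<open>n \<ge> 2\<close> (\<open>denominator_le_powr_diameter\<close>).

  Suppose that a run of \<open>M\<close> points and length \<open>l\<close> is followed by a point \<open>w\<close> off the curve. Then
  \<open>\<bar>P w - y w\<bar> \<ge> 1 / Q\<close>, while interpolation of \<open>P - f\<close> at points of spacing \<open>b\<close> in the run bounds this
  by \<open>C * \<delta> * (l / b) ^ n\<close>. Either \<open>M\<close> is large compared with \<open>n ^ \<omega>(Q)\<close>, and the density bound provides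
  a spacing \<open>b\<close> of order \<open>M * Q powr (1 / n)\<close>; then \<open>Q\<close> cancels and \<open>M \<le> C * \<delta> powr (1 / n) * l\<close>. Or \<open>M\<close> is
  at most of order \<open>n ^ \<omega>(Q)\<close>, which for \<open>n \<ge> 2\<close> grows more slowly than any positive power of \<open>l\<close>; then
  the bound on \<open>Q\<close> shows that \<open>l\<close> is larger than a power of \<open>L\<close> with exponent greater than 1, so that
  again \<open>M \<le> C * l / L\<close>.
  Either way the run has at most \<open>C * l / L\<close> points (\<open>card_run_le\<close>), and all these runs together have
  \<open>C * X / L\<close> points.

  Only the last run has no point after it, and this is why the term \<open>X powr \<epsilon>\<close> occurs once and not with
  a multiplicity. Its points are counted by the density bound. If \<open>Q\<close> is at least \<open>s / 2\<close>, this gives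
  \<open>X / s powr (1 / n) + X powr \<epsilon>\<close>. If \<open>Q\<close> is smaller, the leading coefficients of \<open>P\<close> and \<open>f\<close> differ by at
  least \<open>1 / (2 * Q * s)\<close>, and interpolation at points of spacing \<open>M * Q powr (1 / n)\<close> again makes \<open>Q\<close>
  cancel and yields \<open>M \<le> C * \<delta> powr (1 / n) * X\<close> (\<open>card_on_curve_le\<close>).

  For \<open>n = 1\<close> one has \<open>n ^ \<omega>(Q) = 1\<close>, so that \<open>l \<ge> L\<close> suffices in the second alternative, which
  follows from \<open>Q \<le> B\<close>, and \<open>\<epsilon> = 0\<close> is admissible throughout. The second part of the theorem is this case of the same estimate.
\<close>

section \<open>Vandermonde products\<close>

text \<open>
  The absolute value of the Vandermonde determinant of the points of \<open>T\<close>. Writing it as a product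
  over pairs of elements of a set makes it independent of an enumeration of \<open>T\<close>.
\<close>

definition vdm :: "int set \<Rightarrow> int" where
  "vdm T = (\<Prod>x\<in>T. \<Prod>y\<in>{y \<in> T. y < x}. x - y)"

lemma vdm_empty [simp]: "vdm {} = 1"
  by (simp add: vdm_def)

lemma vdm_pos: "vdm T > 0"
  unfolding vdm_def by (intro prod_pos) auto

lemma vdm_insert:
  assumes "finite T" "x \<notin> T"
  shows "vdm (insert x T) = vdm T * (\<Prod>y\<in>T. \<bar>x - y\<bar>)"
proof -
  have split: "(\<Prod>y\<in>T. \<bar>x - y\<bar>)
      = (\<Prod>y\<in>{y \<in> T. y < x}. x - y) * (\<Prod>y\<in>T. if x < y then y - x else 1)"
  proof -
    have "(\<Prod>y\<in>T. \<bar>x - y\<bar>)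
        = (\<Prod>y\<in>T. (if y < x then x - y else 1) * (if x < y then y - x else 1))"
      using assms by (intro prod.cong) auto
    then show ?thesis
      using assms by (simp add: prod.distrib prod.inter_filter)
  qed
  have below: "(\<Prod>y\<in>{y \<in> insert x T. y < z}. z - y)
      = (\<Prod>y\<in>{y \<in> T. y < z}. z - y) * (if x < z then z - x else 1)" if "z \<in> T" for z
  proof (cases "x < z")
    case True
    then have "{y \<in> insert x T. y < z} = insert x {y \<in> T. y < z}" by auto
    then show ?thesis using assms True by simp
  next
    case False
    then have "{y \<in> insert x T. y < z} = {y \<in> T. y < z}" by auto
    then show ?thesis using False by simp
  qed
  have "{y \<in> insert x T. y < x} = {y \<in> T. y < x}" by auto
  then have "vdm (insert x T) = (\<Prod>y\<in>{y \<in> T. y < x}. x - y)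
      * (\<Prod>z\<in>T. (\<Prod>y\<in>{y \<in> T. y < z}. z - y) * (if x < z then z - x else 1))"
    unfolding vdm_def using assms below by (simp cong: prod.cong)
  then show ?thesis
    unfolding split by (simp add: vdm_def prod.distrib mult_ac)
qed

lemma vdm_remove:
  assumes "finite T" "x \<in> T"
  shows "vdm T = vdm (T - {x}) * (\<Prod>y\<in>T - {x}. \<bar>x - y\<bar>)"
  using vdm_insert[of "T - {x}" x] assms by (simp add: insert_absorb)

lemma choose_two_Suc: "Suc n choose 2 = n + (n choose 2)"
  using binomial_Suc_Suc[of n 1] by (simp add: numeral_2_eq_2)

lemma vdm_le:
  assumes "finite T" "\<And>x y. x \<in> T \<Longrightarrow> y \<in> T \<Longrightarrow> real_of_int \<bar>x - y\<bar> \<le> B" "B \<ge> 0"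
  shows "real_of_int (vdm T) \<le> B ^ (card T choose 2)"
  using assms
proof (induction T rule: finite_induct)
  case (insert x T)
  have "real_of_int (\<Prod>y\<in>T. \<bar>x - y\<bar>) \<le> (\<Prod>y\<in>T. B)"
    unfolding of_int_prod using insert.prems by (intro prod_mono) auto
  moreover have "real_of_int (vdm T) \<le> B ^ (card T choose 2)"
    using insert by auto
  ultimately have "real_of_int (vdm T * (\<Prod>y\<in>T. \<bar>x - y\<bar>)) \<le> B ^ (card T choose 2) * B ^ card T"
    unfolding of_int_mult using vdm_pos[of T] insert.prems
    by (intro mult_mono) (auto intro!: prod_nonneg)
  then show ?case
    using insert.hyps by (simp add: vdm_insert choose_two_Suc power_add mult_ac)
qed (auto simp: numeral_2_eq_2)

lemma power_dvd_vdm: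
  assumes "finite T" "\<And>x y. x \<in> T \<Longrightarrow> y \<in> T \<Longrightarrow> d dvd x - y"
  shows "d ^ (card T choose 2) dvd vdm T"
  using assms
proof (induction T rule: finite_induct)
  case (insert x T)
  have "(\<Prod>y\<in>T. d) dvd (\<Prod>y\<in>T. \<bar>x - y\<bar>)"
    using insert.prems by (intro prod_dvd_prod) auto
  then have "d ^ (card T choose 2) * d ^ card T dvd vdm T * (\<Prod>y\<in>T. \<bar>x - y\<bar>)"
    using insert by (intro mult_dvd_mono) auto
  then show ?case
    using insert.hyps by (simp add: vdm_insert choose_two_Suc power_add mult_ac)
qed (auto simp: numeral_2_eq_2)

section \<open>Lagrange interpolation at integer points\<close>

definition nodal :: "int set \<Rightarrow> real poly" where
  "nodal A = (\<Prod>y\<in>A. [:- real_of_int y, 1:])"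

definition lagrange :: "int set \<Rightarrow> (int \<Rightarrow> real) \<Rightarrow> real poly" where
  "lagrange X g = (\<Sum>x\<in>X. smult (g x / (\<Prod>y\<in>X - {x}. of_int (x - y))) (nodal (X - {x})))"

lemma poly_nodal: "poly (nodal A) z = (\<Prod>y\<in>A. z - of_int y)"
  by (simp add: nodal_def poly_prod)

lemma degree_nodal: "finite A \<Longrightarrow> degree (nodal A) = card A"
  unfolding nodal_def by (subst degree_prod_sum_eq) auto

lemma lead_coeff_nodal: "finite A \<Longrightarrow> coeff (nodal A) (card A) = 1"
  using degree_nodal[of A] lead_coeff_prod[of "\<lambda>y. [:- real_of_int y, 1:]" A]
  by (simp add: nodal_def)

lemma degree_lagrange:
  assumes "card X = Suc n"
  shows "degree (lagrange X g) \<le> n"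
proof -
  have "finite X" using assms by (simp add: card_ge_0_finite)
  then show ?thesis
    unfolding lagrange_def using assms
    by (intro degree_sum_le order.trans[OF degree_smult_le]) (auto simp: degree_nodal)
qed

lemma poly_lagrange:
  "poly (lagrange X g) z
    = (\<Sum>x\<in>X. g x * (\<Prod>y\<in>X - {x}. z - of_int y) / (\<Prod>y\<in>X - {x}. of_int (x - y)))"
  by (simp add: lagrange_def poly_sum poly_nodal)

lemma coeff_lagrange:
  assumes "card X = Suc n"
  shows "coeff (lagrange X g) n = (\<Sum>x\<in>X. g x / (\<Prod>y\<in>X - {x}. of_int (x - y)))"
proof -
  have fin: "finite X" using assms by (simp add: card_ge_0_finite)
  have "coeff (nodal (X - {x})) n = 1" if "x \<in> X" for x
    using lead_coeff_nodal[of "X - {x}"] that fin assms by simp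
  then show ?thesis
    by (simp add: lagrange_def coeff_sum)
qed

lemma poly_lagrange_node:
  assumes "finite X" "w \<in> X"
  shows "poly (lagrange X g) (of_int w) = g w"
proof -
  have "(\<Prod>y\<in>X - {w}. real_of_int (w - y)) \<noteq> 0"
    using assms by auto
  then have main: "g w * (\<Prod>y\<in>X - {w}. of_int w - of_int y) / (\<Prod>y\<in>X - {w}. of_int (w - y)) = g w"
    by simp
  have "poly (lagrange X g) (of_int w)
    = (\<Sum>x\<in>X. if x = w then g w else 0)"
    unfolding poly_lagrange
  proof (intro sum.cong refl)
    fix x assume "x \<in> X"
    show "g x * (\<Prod>y\<in>X - {x}. real_of_int w - real_of_int y) / (\<Prod>y\<in>X - {x}. real_of_int (x - y))
        = (if x = w then g w else 0)"
      using main assms by (cases "x = w") (auto intro!: prod_zero)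
  qed
  then show ?thesis using assms by simp
qed

lemma poly_eq_of_agree:
  fixes p q :: "real poly"
  assumes "card X = Suc n" "degree p \<le> n" "degree q \<le> n"
    and "\<And>x. x \<in> X \<Longrightarrow> poly p (of_int x) = poly q (of_int x)"
  shows "p = q"
proof (rule ccontr)
  assume "p \<noteq> q"
  then have nz: "p - q \<noteq> 0" by simp
  have fin: "finite {z. poly (p - q) z = 0}" using nz poly_roots_finite by blast
  have "real_of_int ` X \<subseteq> {z. poly (p - q) z = 0}" using assms by auto
  then have "card (real_of_int ` X) \<le> degree (p - q)"
    using order.trans[OF card_mono[OF fin] card_poly_roots_bound[OF nz]] by blast
  moreover have "card (real_of_int ` X) = card X"
    by (intro card_image) (auto simp: inj_on_def)
  moreover have "degree (p - q) \<le> n"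
    using assms degree_diff_le by blast
  ultimately show False using assms by simp
qed

lemma lagrange_self:
  assumes "card X = Suc n" "degree p \<le> n"
  shows "lagrange X (\<lambda>x. poly p (of_int x)) = p"
proof -
  have "finite X" using assms by (simp add: card_ge_0_finite)
  with assms degree_lagrange show ?thesis
    by (intro poly_eq_of_agree[of X n]) (auto simp: poly_lagrange_node)
qed

section \<open>Denominators of polynomials through integer points\<close>

definition integral_poly :: "real poly \<Rightarrow> bool" where
  "integral_poly p \<longleftrightarrow> (\<forall>i. coeff p i \<in> \<int>)"

lemma integral_poly_add: "integral_poly p \<Longrightarrow> integral_poly q \<Longrightarrow> integral_poly (p + q)"
  by (auto simp: integral_poly_def)

lemma integral_poly_sum: "(\<And>x. x \<in> A \<Longrightarrow> integral_poly (h x)) \<Longrightarrow> integral_poly (sum h A)"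
  by (auto simp: integral_poly_def coeff_sum)

lemma integral_poly_smult: "c \<in> \<int> \<Longrightarrow> integral_poly p \<Longrightarrow> integral_poly (smult c p)"
  by (auto simp: integral_poly_def)

lemma integral_poly_nodal: "integral_poly (nodal A)"
proof -
  have mult: "integral_poly (p * q)" if "integral_poly p" "integral_poly q" for p q
    using that by (auto simp: integral_poly_def coeff_mult)
  show ?thesis
    unfolding nodal_def
  proof (induction A rule: infinite_finite_induct)
    case (insert x F)
    have "integral_poly [:- real_of_int x, 1:]"
      by (auto simp: integral_poly_def coeff_pCons split: nat.splits)
    then show ?case
      unfolding prod.insert[OF insert.hyps] using insert.IH by (intro mult)
  qed (auto simp: integral_poly_def)
qed

lemma integral_poly_poly: "integral_poly p \<Longrightarrow> poly p (of_int z) \<in> \<int>"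
  by (auto simp: integral_poly_def poly_altdef)

text \<open>
  Says that, for every \<open>(n + 1)\<close>-element \<open>X \<subseteq> R\<close>, the number \<open>Q\<close> divides the least common
  multiple over \<open>x \<in> X\<close> of the products \<open>\<Prod>y\<in>X - {x}. x - y\<close>, which are the denominators in Lagrange's
  formula. It is spelled out for prime powers, because the element \<open>x\<close> that works depends on the
  prime. This property is all that the counting arguments below use about the denominator \<open>Q\<close> of a
  curve that passes through integer points over \<open>R\<close>.
\<close>

definition divides_differences :: "nat \<Rightarrow> nat \<Rightarrow> int set \<Rightarrow> bool" where
  "divides_differences n Q R \<longleftrightarrow> (\<forall>p k X. prime p \<longrightarrow> p ^ k dvd Q \<longrightarrow> X \<subseteq> R \<longrightarrow> card X = Suc n \<longrightarrow>
      (\<exists>x\<in>X. int p ^ k dvd (\<Prod>y\<in>X - {x}. x - y)))"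

lemma divides_differences_subset: "divides_differences n Q R \<Longrightarrow> Y \<subseteq> R \<Longrightarrow> divides_differences n Q Y"
  unfolding divides_differences_def by (meson subset_trans)

lemma prime_power_dvd_lcm:
  fixes a b :: int
  assumes "prime p" "p ^ k dvd lcm a b" "a \<noteq> 0" "b \<noteq> 0"
  shows "p ^ k dvd a \<or> p ^ k dvd b"
proof -
  have "k \<le> multiplicity p (lcm a b)"
    by (rule multiplicity_geI)
      (use assms not_prime_unit[of p] in \<open>simp_all only: lcm_eq_0_iff simp_thms\<close>, blast)
  also have "\<dots> = max (multiplicity p a) (multiplicity p b)"
    using assms by (intro multiplicity_lcm)
  finally have "k \<le> multiplicity p a \<or> k \<le> multiplicity p b"
    by (simp add: le_max_iff_disj)
  then show ?thesis
    using multiplicity_dvd'[of k p a] multiplicity_dvd'[of k p b] by (elim disjE) simp_all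
qed

lemma prime_power_dvd_Lcm:
  fixes h :: "'a \<Rightarrow> int"
  assumes "finite X" "X \<noteq> {}" "prime p" "p ^ k dvd Lcm (h ` X)" "\<And>x. x \<in> X \<Longrightarrow> h x \<noteq> 0"
  shows "\<exists>x\<in>X. p ^ k dvd h x"
  using assms
proof (induction X rule: finite_ne_induct)
  case (singleton x)
  then show ?case by simp
next
  case (insert x F)
  have "Lcm (h ` F) \<noteq> 0" using insert by (subst Lcm_0_iff) auto
  then have "p ^ k dvd h x \<or> p ^ k dvd Lcm (h ` F)"
    using insert by (intro prime_power_dvd_lcm) auto
  then show ?case
  proof
    assume "p ^ k dvd Lcm (h ` F)"
    then have "\<exists>x\<in>F. p ^ k dvd h x"
      using insert.prems by (intro insert.IH) auto
    then show ?case unfolding bex_simps(5) by (rule disjI2)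
  next
    assume "p ^ k dvd h x"
    then show ?case unfolding bex_simps(5) by (rule disjI1)
  qed
qed

lemma integral_lagrange_denominator:
  assumes X: "card X = Suc n" and "degree P \<le> n"
    and int: "\<And>x. x \<in> X \<Longrightarrow> poly P (of_int x) \<in> \<int>"
    and dvd: "\<And>x. x \<in> X \<Longrightarrow> (\<Prod>y\<in>X - {x}. x - y) dvd M"
  shows "integral_poly (smult (of_int M) P)"
proof -
  have fin: "finite X" using X by (simp add: card_ge_0_finite)
  have "integral_poly (smult (of_int M) (smult (poly P (of_int x) /
      (\<Prod>y\<in>X - {x}. of_int (x - y))) (nodal (X - {x}))))" if x: "x \<in> X" for x
  proof -
    obtain c where c: "M = (\<Prod>y\<in>X - {x}. x - y) * c" using dvd[OF x] by blast
    have nz: "(\<Prod>y\<in>X - {x}. real_of_int (x - y)) \<noteq> 0" using fin by auto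
    have "real_of_int M * (poly P (of_int x) / (\<Prod>y\<in>X - {x}. of_int (x - y)))
        = of_int c * poly P (of_int x)"
      using nz unfolding c of_int_mult of_int_prod by (simp add: field_simps)
    then show ?thesis
      using int[OF x] by (auto intro!: integral_poly_smult integral_poly_nodal)
  qed
  then have "integral_poly (\<Sum>x\<in>X. smult (of_int M) (smult (poly P (of_int x) /
      (\<Prod>y\<in>X - {x}. of_int (x - y))) (nodal (X - {x}))))"
    by (rule integral_poly_sum)
  moreover have "smult c (sum q X) = (\<Sum>x\<in>X. smult c (q x))" for c :: real and q
    by (induction X rule: infinite_finite_induct) (auto simp: smult_add_right)
  ultimately have "integral_poly (smult (of_int M) (lagrange X (\<lambda>x. poly P (of_int x))))"
    by (simp only: lagrange_def)
  then show ?thesis using lagrange_self[OF X] assms by simp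
qed

text \<open>
  \<open>Q\<close> is the least common denominator of the coefficients of \<open>P\<close>. Interpolation at any \<open>n + 1\<close>
  points of \<open>R\<close> writes \<open>P\<close> as an integer combination of integral polynomials divided by the products
  of differences, so the least common multiple of these products clears all denominators and is
  divisible by \<open>Q\<close>.
\<close>

lemma denominator_exists:
  assumes "finite R" "card R \<ge> Suc n" "degree P \<le> n"
    and int: "\<And>x. x \<in> R \<Longrightarrow> poly P (of_int x) \<in> \<int>"
  obtains Q :: nat where "Q \<ge> 1" "integral_poly (smult (of_nat Q) P)" "divides_differences n Q R"
proof -
  define h where "h X x = (\<Prod>y\<in>X - {x}. x - y)" for X :: "int set" and x
  define good where "good m \<longleftrightarrow> m \<ge> 1 \<and> integral_poly (smult (of_nat m) P)" for m :: nat
  define Q where "Q = (LEAST m. good m)"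
  have lcm_good: "good (nat (Lcm (h X ` X)))" if X: "X \<subseteq> R" "card X = Suc n" for X
  proof -
    have fin: "finite X" using X assms finite_subset by blast
    have "Lcm (h X ` X) \<noteq> 0"
      using fin by (subst Lcm_0_iff) (auto simp: h_def)
    moreover have "Lcm (h X ` X) \<ge> 0" by simp
    ultimately have pos: "Lcm (h X ` X) > 0" by linarith
    have "integral_poly (smult (of_int (Lcm (h X ` X))) P)"
      using X assms by (intro integral_lagrange_denominator[of X n]) (auto simp: h_def[symmetric])
    then show ?thesis
      unfolding good_def using pos by simp
  qed
  obtain X0 where "X0 \<subseteq> R" "card X0 = Suc n"
    using assms obtain_subset_with_card_n by metis
  with lcm_good have "\<exists>m. good m" by blast
  then have Q: "good Q" unfolding Q_def by (meson LeastI_ex)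
  \<comment> \<open>The common denominators of \<open>P\<close> are closed under remainders, so the least one divides all.\<close>
  have Q_dvd: "Q dvd m" if "good m" for m
  proof (rule ccontr)
    assume "\<not> Q dvd m"
    then have pos: "m mod Q > 0" by (simp add: dvd_eq_mod_eq_0)
    have "real (m mod Q) = of_nat m + of_int (- int (m div Q)) * of_nat Q"
      using arg_cong[OF mod_mult_div_eq[of m Q], of real]
      unfolding of_nat_add of_nat_mult by (simp add: algebra_simps)
    then have "smult (of_nat (m mod Q)) P = smult (of_nat m) P
        + smult (of_int (- int (m div Q))) (smult (of_nat Q) P)"
      by (simp only: smult_add_left smult_smult)
    then have "integral_poly (smult (of_nat (m mod Q)) P)"
      using that Q unfolding good_def
      by (metis integral_poly_add integral_poly_smult Ints_of_int)
    then have "good (m mod Q)" using pos by (simp add: good_def)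
    then have "Q \<le> m mod Q" unfolding Q_def by (rule Least_le)
    moreover have "m mod Q < Q" using Q by (simp add: good_def)
    ultimately show False by simp
  qed
  have "divides_differences n Q R"
    unfolding divides_differences_def
  proof (intro allI impI)
    fix p k X assume p: "prime p" "p ^ k dvd Q" and X: "X \<subseteq> R" "card X = Suc n"
    have fin: "finite X" using X assms finite_subset by blast
    have "p ^ k dvd nat (Lcm (h X ` X))"
      using p Q_dvd[OF lcm_good[OF X]] dvd_trans by blast
    then have "int p ^ k dvd Lcm (h X ` X)"
      by (metis Lcm_int_greater_eq_0 int_dvd_int_iff int_nat_eq of_nat_power)
    then show "\<exists>x\<in>X. int p ^ k dvd (\<Prod>y\<in>X - {x}. x - y)"
      unfolding h_def[symmetric]
      using p X fin by (intro prime_power_dvd_Lcm) (auto simp: h_def)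
  qed
  then show ?thesis using that Q good_def by blast
qed

section \<open>Residue classes of the points on a curve\<close>

text \<open>
  One of the \<open>n\<close>-fold products of differences is divisible by \<open>p ^ k\<close> although none of its factors is
  divisible by \<open>p ^ Suc m\<close>. This is only possible if \<open>k = n * m\<close> and every factor has valuation
  exactly \<open>m\<close>.
\<close>

lemma incongruent_tuple:
  fixes p :: nat
  assumes p: "prime p" "p ^ k dvd Q" and dd: "divides_differences n Q R"
    and X: "X \<subseteq> R" "card X = Suc n" "inj_on (\<lambda>x. x mod int p ^ Suc m) X" and m: "n * m \<le> k"
  shows "k = n * m \<and> (\<forall>x\<in>X. \<forall>y\<in>X. int p ^ m dvd x - y)"
proof -
  have fin: "finite X" using X by (simp add: card_ge_0_finite)
  have pp: "prime_elem (int p)" using p by simp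
  obtain x where x: "x \<in> X" and dvd: "int p ^ k dvd (\<Prod>y\<in>X - {x}. x - y)"
    using dd p X unfolding divides_differences_def by blast
  let ?v = "\<lambda>y. multiplicity (int p) (x - y)"
  have le: "?v y \<le> m" if "y \<in> X - {x}" for y
  proof (rule ccontr)
    assume "\<not> ?v y \<le> m"
    then have "int p ^ Suc m dvd x - y" by (intro multiplicity_dvd') auto
    then have "x mod int p ^ Suc m = y mod int p ^ Suc m" by (simp only: mod_eq_dvd_iff)
    then show False using X x that by (auto dest: inj_onD)
  qed
  have "k \<le> multiplicity (int p) (\<Prod>y\<in>X - {x}. x - y)"
    using dvd fin p by (intro multiplicity_geI) auto
  also have "\<dots> = (\<Sum>y\<in>X - {x}. ?v y)"
    using fin pp by (intro prime_elem_multiplicity_prod_distrib) auto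
  finally have ge: "k \<le> (\<Sum>y\<in>X - {x}. ?v y)" .
  have const: "(\<Sum>y\<in>X - {x}. m) = n * m" using x X fin by simp
  have "(\<Sum>y\<in>X - {x}. ?v y) \<le> n * m"
    using sum_mono[of "X - {x}" ?v "\<lambda>_. m", OF le] unfolding const .
  then have k: "k = n * m" and eq: "(\<Sum>y\<in>X - {x}. ?v y) = (\<Sum>y\<in>X - {x}. m)"
    using ge m const by linarith+
  have "?v y = m" if "y \<in> X - {x}" for y
  proof (rule ccontr)
    assume "?v y \<noteq> m"
    then have "?v y < m" using le[OF that] by simp
    then have "(\<Sum>y\<in>X - {x}. ?v y) < (\<Sum>y\<in>X - {x}. m)"
      using fin le that by (intro sum_strict_mono_ex1) auto
    then show False using eq by simp
  qed
  then have *: "int p ^ m dvd x - y" if "y \<in> X" for y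
    using that by (cases "y = x") (auto intro!: multiplicity_dvd')
  have "int p ^ m dvd y - z" if "y \<in> X" "z \<in> X" for y z
    using dvd_diff[OF *[OF that(2)] *[OF that(1)]] by simp
  then show ?thesis using k by blast
qed

lemma card_residues_le:
  fixes p :: nat
  assumes "prime p" "p ^ k dvd Q" "divides_differences n Q R" "n * m < k"
  shows "card ((\<lambda>x. x mod int p ^ Suc m) ` R) \<le> n"
proof (rule ccontr)
  let ?r = "\<lambda>x. x mod int p ^ Suc m"
  assume "\<not> ?thesis"
  then obtain C where C: "C \<subseteq> ?r ` R" "card C = Suc n"
    using obtain_subset_with_card_n[of "Suc n" "?r ` R"] by (metis not_less_eq_eq)
  then obtain X where X: "X \<subseteq> R" "inj_on ?r X" "C = ?r ` X"
    by (meson subset_image_inj)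
  then have "card X = Suc n" using C card_image by metis
  then show False using incongruent_tuple[OF assms(1-3) X(1) _ X(2)] assms(4) by simp
qed

text \<open>
  In the boundary case \<open>k = n * m\<close> of \<open>incongruent_tuple\<close> the whole tuple lies in one class modulo
  \<open>p ^ m\<close>; a tuple that contains two points of different classes modulo \<open>p ^ m\<close> excludes this.
\<close>

lemma card_residues_le_or_congruent:
  fixes p :: nat
  assumes "prime p" "p ^ k dvd Q" "divides_differences n Q R" "n * m \<le> k" "n \<ge> 1"
    and uw: "u \<in> R" "w \<in> R" "\<not> int p ^ m dvd u - w"
  shows "card ((\<lambda>x. x mod int p ^ Suc m) ` R) \<le> n"
proof (rule ccontr)
  let ?r = "\<lambda>x. x mod int p ^ Suc m"
  assume big: "\<not> ?thesis"
  have uw': "?r u \<noteq> ?r w"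
  proof
    assume "?r u = ?r w"
    then have "int p ^ Suc m dvd u - w" by (simp only: mod_eq_dvd_iff)
    then show False using uw(3) by (meson dvd_trans le_imp_power_dvd le_SucI order_refl)
  qed
  have "finite (?r ` R)" using big by (metis card.infinite le0)
  then obtain C where C: "{?r u, ?r w} \<subseteq> C" "C \<subseteq> ?r ` R" "card C = Suc n"
    using exists_subset_between[of "{?r u, ?r w}" "Suc n" "?r ` R"] big uw assms(5) uw'
    by auto
  \<comment> \<open>Representatives of the classes in \<open>C\<close>, with \<open>u\<close> and \<open>w\<close> representing their own classes.\<close>
  define g where "g c = (if c = ?r u then u else if c = ?r w then w else (SOME x. x \<in> R \<and> ?r x = c))"
    for c
  have g: "g c \<in> R \<and> ?r (g c) = c" if "c \<in> C" for c
  proof -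
    have "\<exists>x. x \<in> R \<and> ?r x = c" using that C by blast
    then have "(SOME x. x \<in> R \<and> ?r x = c) \<in> R \<and> ?r (SOME x. x \<in> R \<and> ?r x = c) = c"
      by (rule someI_ex)
    then show ?thesis using uw uw' by (auto simp: g_def)
  qed
  have X: "g ` C \<subseteq> R" "inj_on ?r (g ` C)" "inj_on g C"
    using g by (auto simp: inj_on_def) metis
  have "card (g ` C) = Suc n" using C X card_image by metis
  moreover have "u \<in> g ` C" "w \<in> g ` C"
    using C uw' by (auto simp: g_def image_iff intro!: bexI[of _ "?r u"] bexI[of _ "?r w"])
  ultimately show False
    using incongruent_tuple[OF assms(1-3) X(1) _ X(2) assms(4)] uw by blast
qed

text \<open>
  The density of the admissible residue classes at \<open>p\<close> is at most \<open>p powr (- k / n)\<close>, without any loss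
  for all but finitely many primes. Bounding the number of classes modulo the least power of \<open>p\<close> that
  is at least \<open>p powr (k / n)\<close> by \<open>n\<close> gives this up to the factor \<open>n\<close>; the loss would accumulate over
  the primes dividing \<open>Q\<close>. It is avoided by the strict gain of \<open>p powr (1 / n)\<close> from rounding up,
  and, when \<open>n\<close> divides \<open>k\<close>, by the alternative of a single class against few classes modulo the next
  power.
\<close>

lemma local_density:
  fixes p :: nat
  assumes p: "prime p" "p ^ k dvd Q" and dd: "divides_differences n Q R" and n: "n \<ge> 1"
  obtains m where "card ((\<lambda>x. x mod int p ^ m) ` R) \<le> n"
    "real (card ((\<lambda>x. x mod int p ^ m) ` R)) / real p ^ m
      \<le> (if p \<le> n ^ n then real n else 1) * real p powr (- (real k / real n))"
proof -
  \<comment> \<open>The modulus is \<open>p ^ m\<close> in the case of one class, and \<open>p ^ Suc m\<close> otherwise.\<close>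
  define m where "m = k div n"
  have nm: "n * m \<le> k" "k < n * Suc m"
    using n by (auto simp: m_def dividend_less_times_div)
  have p1: "real p > 1" using p prime_gt_1_nat by auto
  show thesis
  proof (cases "n * m = k \<and> (\<forall>u\<in>R. \<forall>w\<in>R. int p ^ m dvd u - w)")
    case True
    have "card ((\<lambda>x. x mod int p ^ m) ` R) \<le> 1"
    proof (cases "R = {}")
      case False
      then obtain u where u: "u \<in> R" by blast
      have "w mod int p ^ m = u mod int p ^ m" if "w \<in> R" for w
        using True u that by (simp add: mod_eq_dvd_iff)
      then have "(\<lambda>x. x mod int p ^ m) ` R \<subseteq> {u mod int p ^ m}" by auto
      then have "card ((\<lambda>x. x mod int p ^ m) ` R) \<le> card {u mod int p ^ m}"
        by (intro card_mono) auto
      then show ?thesis by simp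
    qed auto
    moreover have "1 / real p ^ m = real p powr (- (real k / real n))"
    proof -
      have "real k / real n = real m" using True[THEN conjunct1, symmetric] n by simp
      then show ?thesis using p1 by (simp only: powr_minus powr_realpow) (simp add: divide_simps)
    qed
    ultimately have "real (card ((\<lambda>x. x mod int p ^ m) ` R)) / real p ^ m
        \<le> real p powr (- (real k / real n))"
      using p1 by (smt (verit) divide_right_mono of_nat_1 of_nat_mono zero_le_power)
    also have "\<dots> \<le> (if p \<le> n ^ n then real n else 1) * real p powr (- (real k / real n))"
      using n by (auto simp: mult_le_cancel_right1)
    finally show ?thesis
      using that[of m] n \<open>card _ \<le> 1\<close> by simp
  next
    case False
    have le: "card ((\<lambda>x. x mod int p ^ Suc m) ` R) \<le> n"
    proof (cases "n * m = k")
      case True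
      then obtain u w where "u \<in> R" "w \<in> R" "\<not> int p ^ m dvd u - w" using False by blast
      then show ?thesis using card_residues_le_or_congruent[OF p dd nm(1) n] by blast
    next
      case False
      then show ?thesis using card_residues_le[OF p dd] nm by simp
    qed
    have "real (card ((\<lambda>x. x mod int p ^ Suc m) ` R)) / real p ^ Suc m \<le> real n / real p ^ Suc m"
      using le p1 by (intro divide_right_mono) auto
    also have "\<dots> = real n * real p powr (- real (Suc m))"
    proof -
      have "real p powr (- real (Suc m)) = inverse (real p ^ Suc m)"
        unfolding powr_minus using p1 by (subst powr_realpow) auto
      then show ?thesis by (simp only: divide_inverse)
    qed
    \<comment> \<open>Rounding the exponent up gains at least \<open>1 / n\<close>, as \<open>k < n * Suc m\<close>.\<close>
    also have "\<dots> \<le> real n * real p powr (- (real k / real n) + - (1 / real n))"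
    proof -
      have "real (k + 1) \<le> real (n * Suc m)"
        using nm(2) by (subst of_nat_le_iff) simp
      then have "real k + 1 \<le> real (Suc m) * real n"
        by (simp only: of_nat_mult of_nat_add of_nat_1 mult.commute)
      then have "(real k + 1) / real n \<le> real (Suc m)"
        using n by (simp only: pos_divide_le_eq)
      then have "real k / real n + 1 / real n \<le> real (Suc m)"
        by (simp only: add_divide_distrib)
      then show ?thesis using p1 by (intro mult_left_mono powr_mono) auto
    qed
    also have "\<dots> = (real n * real p powr (- (1 / real n))) * real p powr (- (real k / real n))"
      by (subst powr_add) simp
    also have "\<dots> \<le> (if p \<le> n ^ n then real n else 1) * real p powr (- (real k / real n))"
    proof (rule mult_right_mono)
      show "real n * real p powr (- (1 / real n)) \<le> (if p \<le> n ^ n then real n else 1)"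
      proof (cases "p \<le> n ^ n")
        case True
        have "real p powr (- (1 / real n)) \<le> real p powr 0" using p1 by (intro powr_mono) auto
        then show ?thesis using True n p1 by (simp add: mult_le_cancel_left1)
      next
        case False
        have "real n = (real n ^ n) powr (1 / real n)"
          using n by (simp add: powr_powr flip: powr_realpow)
        also have "\<dots> \<le> real p powr (1 / real n)"
          using False n by (intro powr_mono2) (auto simp flip: of_nat_power)
        finally show ?thesis
          using False p1 by (simp add: powr_minus divide_simps)
      qed
    qed auto
    finally show ?thesis using that[of "Suc m"] le by simp
  qed
qed

lemma card_le_fibres:
  assumes "finite X" "\<And>c. c \<in> h ` X \<Longrightarrow> card {x \<in> X. h x = c} \<le> b"
  shows "card X \<le> card (h ` X) * b"
proof -
  have "card X = (\<Sum>c\<in>h ` X. card {x \<in> X. h x = c})"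
    using sum.image_gen[OF assms(1), of "\<lambda>_. 1::nat" h] by simp
  also have "\<dots> \<le> (\<Sum>c\<in>h ` X. b)" using assms by (intro sum_mono) auto
  finally show ?thesis by simp
qed

text \<open>
  By the Chinese remainder theorem a residue modulo \<open>a * b\<close> is determined by its two reductions.
\<close>

lemma card_residues_mult:
  fixes a b :: int
  assumes "coprime a b" "finite R"
  shows "card ((\<lambda>x. x mod (a * b)) ` R)
    \<le> card ((\<lambda>x. x mod a) ` R) * card ((\<lambda>x. x mod b) ` R)"
proof -
  let ?h = "\<lambda>c. (c mod a, c mod b)"
  have "inj_on ?h ((\<lambda>x. x mod (a * b)) ` R)"
  proof (rule inj_onI)
    fix c d assume "c \<in> (\<lambda>x. x mod (a * b)) ` R" "d \<in> (\<lambda>x. x mod (a * b)) ` R" "?h c = ?h d"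
    then obtain x y where xy: "c = x mod (a * b)" "d = y mod (a * b)" by blast
    have "a dvd c - d" "b dvd c - d" using \<open>?h c = ?h d\<close> by (auto simp: mod_eq_dvd_iff)
    then have "a * b dvd c - d" using assms(1) by (rule divides_mult)
    then have "c mod (a * b) = d mod (a * b)" by (simp only: mod_eq_dvd_iff)
    then show "c = d" using xy by simp
  qed
  moreover have "?h ` (\<lambda>x. x mod (a * b)) ` R \<subseteq> (\<lambda>x. x mod a) ` R \<times> (\<lambda>x. x mod b) ` R"
  proof -
    have "?h (x mod (a * b)) = (x mod a, x mod b)" for x by (simp add: mod_mod_cancel)
    then show ?thesis by (simp add: image_image image_subset_iff)
  qed
  ultimately have "card ((\<lambda>x. x mod (a * b)) ` R)
      \<le> card ((\<lambda>x. x mod a) ` R \<times> (\<lambda>x. x mod b) ` R)"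
    using assms(2) by (intro card_inj_on_le) auto
  then show ?thesis by (simp only: card_cartesian_product)
qed

lemma card_residues_prod:
  fixes m :: "nat \<Rightarrow> nat"
  assumes "finite P" "\<And>p. p \<in> P \<Longrightarrow> prime p" "finite R"
  shows "card ((\<lambda>x. x mod (\<Prod>p\<in>P. int p ^ m p)) ` R)
    \<le> (\<Prod>p\<in>P. card ((\<lambda>x. x mod int p ^ m p) ` R))"
  using assms(1,2)
proof (induction P rule: finite_induct)
  case empty
  have "(\<lambda>x::int. 0::int) ` R \<subseteq> {0}" by auto
  then show ?case using card_mono[of "{0::int}"] by fastforce
next
  case (insert p P)
  have "coprime (int p ^ m p) (\<Prod>q\<in>P. int q ^ m q)"
    using insert by (intro prod_coprime_right) (auto intro!: primes_coprime)
  then have "card ((\<lambda>x. x mod (\<Prod>p\<in>insert p P. int p ^ m p)) ` R)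
     \<le> card ((\<lambda>x. x mod int p ^ m p) ` R) * card ((\<lambda>x. x mod (\<Prod>p\<in>P. int p ^ m p)) ` R)"
    using insert.hyps assms(3) by (simp add: card_residues_mult)
  also have "\<dots> \<le> card ((\<lambda>x. x mod int p ^ m p) ` R) * (\<Prod>p\<in>P. card ((\<lambda>x. x mod int p ^ m p) ` R))"
    using insert by (intro mult_left_mono) auto
  finally show ?case using insert.hyps by simp
qed

lemma card_le_residues:
  fixes N :: int
  assumes "finite R" "N > 0" "h \<ge> 0" "\<And>x y. x \<in> R \<Longrightarrow> y \<in> R \<Longrightarrow> real_of_int \<bar>x - y\<bar> \<le> h"
  shows "real (card R) \<le> real (card ((\<lambda>x. x mod N) ` R)) * (h / of_int N + 1)"
proof (cases "R = {}")
  case False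
  define u where "u = Min R"
  have u: "u \<in> R" "\<And>x. x \<in> R \<Longrightarrow> u \<le> x" using assms(1) False by (auto simp: u_def)
  define b where "b = nat \<lfloor>h / of_int N\<rfloor> + 1"
  have "card {x \<in> R. x mod N = c} \<le> b" for c
  proof -
    let ?g = "\<lambda>x. (x - u) div N"
    have "inj_on ?g {x \<in> R. x mod N = c}"
    proof (rule inj_onI)
      fix x y assume x: "x \<in> {x \<in> R. x mod N = c}" and y: "y \<in> {x \<in> R. x mod N = c}"
        and g: "?g x = ?g y"
      have "(x - u) mod N = (y - u) mod N" using x y by (metis (mono_tags) mem_Collect_eq mod_diff_left_eq)
      then show "x = y" using g by (metis div_mult_mod_eq diff_add_cancel)
    qed
    moreover have "?g ` {x \<in> R. x mod N = c} \<subseteq> {0..\<lfloor>h / of_int N\<rfloor>}"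
    proof clarify
      fix x assume x: "x \<in> R"
      have "real_of_int (?g x) \<le> of_int (x - u) / of_int N"
        by (metis floor_divide_of_int_eq of_int_floor_le)
      also have "\<dots> \<le> h / of_int N"
        using assms(4)[OF x u(1)] assms(2) by (intro divide_right_mono) auto
      finally show "?g x \<in> {0..\<lfloor>h / of_int N\<rfloor>}"
        using u(2)[OF x] assms(2) by (simp add: le_floor_iff pos_imp_zdiv_nonneg_iff)
    qed
    ultimately have "card {x \<in> R. x mod N = c} \<le> card {0..\<lfloor>h / of_int N\<rfloor>}"
      by (meson card_inj_on_le finite_atLeastAtMost_int)
    moreover have "\<lfloor>h / of_int N\<rfloor> \<ge> 0" using assms by simp
    ultimately show ?thesis by (simp add: b_def nat_add_distrib)
  qed
  then have "card R \<le> card ((\<lambda>x. x mod N) ` R) * b"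
    using card_le_fibres[OF assms(1), of "\<lambda>x. x mod N" b] by blast
  then have "real (card R) \<le> real (card ((\<lambda>x. x mod N) ` R)) * real b"
    by (metis of_nat_le_iff of_nat_mult)
  also have "real b \<le> h / of_int N + 1"
    using assms by (simp add: b_def)
  finally show ?thesis by (simp add: mult_left_mono)
qed (use assms in auto)

text \<open>
  Factors above 1 occur only at indices up to \<open>z\<close>, so there are at most \<open>z\<close> of them. This turns
  pointwise bounds that fail at small primes into bounds with a constant independent of the set.
\<close>

lemma prod_le_exceptional:
  fixes g :: "nat \<Rightarrow> real"
  assumes "finite P" "0 \<notin> P" "c \<ge> 1" "\<And>p. p \<in> P \<Longrightarrow> g p \<le> (if p \<le> z then c else 1)" "\<And>p. p \<in> P \<Longrightarrow> 0 \<le> g p"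
  shows "prod g P \<le> c ^ z"
proof -
  have "prod g P \<le> (\<Prod>p\<in>P. if p \<le> z then c else 1)"
    using assms by (intro prod_mono) auto
  also have "\<dots> = c ^ card {p \<in> P. p \<le> z}"
    using assms(1) by (simp flip: prod.inter_filter)
  also have "\<dots> \<le> c ^ z"
  proof (rule power_increasing)
    have "{p \<in> P. p \<le> z} \<subseteq> {1..z}" using assms(2) by (auto simp: Suc_le_eq intro!: gr0I)
    then show "card {p \<in> P. p \<le> z} \<le> z" using card_mono[of "{1..z}"] by fastforce
  qed (use assms in auto)
  finally show ?thesis .
qed

text \<open>
  The points of \<open>R\<close> fill at most \<open>\<Prod>A p\<close> residue classes modulo \<open>N = \<Prod>p ^ m p\<close>, and an interval of
  length \<open>h\<close> meets each class in at most \<open>h / N + 1\<close> points. The main term is controlled by the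
  densities of \<open>local_density\<close>, and the term 1 contributes \<open>n\<close> to the power of the number of prime
  divisors of \<open>Q\<close>, which is 1 for \<open>n = 1\<close>.
\<close>

lemma card_le_density:
  assumes R: "finite R" and Q: "Q \<ge> 1" and dd: "divides_differences n Q R" and n: "n \<ge> 1" and h: "h \<ge> 0"
    and diam: "\<And>x y. x \<in> R \<Longrightarrow> y \<in> R \<Longrightarrow> real_of_int \<bar>x - y\<bar> \<le> h"
  shows "real (card R)
    \<le> real n ^ (n ^ n) * h * real Q powr (- (1 / real n)) + real n ^ card (prime_factors Q)"
proof -
  define P where "P = prime_factors Q"
  have P: "finite P" "\<And>p. p \<in> P \<Longrightarrow> prime p" by (auto simp: P_def)
  have P0: "0 \<notin> P" using P by (metis not_prime_0)
  define k where "k p = multiplicity p Q" for p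
  have Qprod: "Q = (\<Prod>p\<in>P. p ^ k p)"
    using Q prime_factorization_nat[of Q] by (simp add: P_def k_def)
  let ?c = "\<lambda>p. if p \<le> n ^ n then real n else 1"
  have "\<exists>m. card ((\<lambda>x. x mod int p ^ m) ` R) \<le> n \<and>
    real (card ((\<lambda>x. x mod int p ^ m) ` R)) / real p ^ m \<le> ?c p * real p powr (- (real (k p) / real n))"
    if "p \<in> P" for p
    using local_density[OF P(2)[OF that] multiplicity_dvd dd n] unfolding k_def by blast
  then obtain m where m: "\<And>p. p \<in> P \<Longrightarrow> card ((\<lambda>x. x mod int p ^ m p) ` R) \<le> n"
    "\<And>p. p \<in> P \<Longrightarrow> real (card ((\<lambda>x. x mod int p ^ m p) ` R)) / real p ^ m p
        \<le> ?c p * real p powr (- (real (k p) / real n))"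
    by metis
  define A where "A p = card ((\<lambda>x. x mod int p ^ m p) ` R)" for p
  define N where "N = (\<Prod>p\<in>P. int p ^ m p)"
  have N: "N > 0" using P unfolding N_def by (intro prod_pos) (auto simp: prime_gt_0_nat)
  have "real (card R) \<le> real (card ((\<lambda>x. x mod N) ` R)) * (h / of_int N + 1)"
    using card_le_residues[OF R N h diam] .
  also have "\<dots> \<le> real (\<Prod>p\<in>P. A p) * (h / of_int N + 1)"
    using card_residues_prod[OF P R, of m] N h
    by (intro mult_right_mono add_nonneg_nonneg divide_nonneg_pos)
      (auto simp: N_def A_def simp del: of_nat_prod of_int_prod)
  also have "\<dots> = h * (\<Prod>p\<in>P. real (A p) / real p ^ m p) + (\<Prod>p\<in>P. real (A p))"
    by (simp add: N_def prod_dividef algebra_simps)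
  also have "(\<Prod>p\<in>P. real (A p) / real p ^ m p)
      \<le> (\<Prod>p\<in>P. ?c p * real p powr (- (real (k p) / real n)))"
    using m(2) by (intro prod_mono) (auto simp: A_def)
  also have "\<dots> = (\<Prod>p\<in>P. ?c p) * real Q powr (- (1 / real n))"
  proof -
    have "real p powr (- (real (k p) / real n)) = (real p ^ k p) powr (- (1 / real n))"
      if "p \<in> P" for p
      using P(2)[OF that] by (simp add: powr_powr prime_gt_0_nat flip: powr_realpow)
    then have "(\<Prod>p\<in>P. real p powr (- (real (k p) / real n)))
        = (\<Prod>p\<in>P. real p ^ k p) powr (- (1 / real n))"
      by (simp add: prod_powr_distrib)
    also have "(\<Prod>p\<in>P. real p ^ k p) = real Q" using arg_cong[OF Qprod, of real] by simp
    finally show ?thesis by (simp add: prod.distrib)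
  qed
  also have "(\<Prod>p\<in>P. ?c p) \<le> real n ^ (n ^ n)"
    using P P0 n by (intro prod_le_exceptional) auto
  also have "(\<Prod>p\<in>P. real (A p)) \<le> (\<Prod>p\<in>P. real n)"
    using m(1) by (intro prod_mono) (auto simp: A_def)
  finally show ?thesis using h by (simp add: P_def mult_ac mult_left_mono mult_right_mono)
qed

text \<open>
  For primes above \<open>n powr (1 / \<theta>)\<close> the factor \<open>n\<close> is at most \<open>p powr \<theta>\<close>; only boundedly many
  primes are smaller. For \<open>n = 1\<close> the left-hand side is 1, and the exponent 0 is allowed; this is what
  removes the \<open>X powr \<epsilon>\<close> for linear polynomials.
\<close>

lemma power_card_prime_factors_le_ex:
  assumes n: "n \<ge> 1" and \<theta>: "\<theta> > 0 \<or> n = 1 \<and> \<theta> \<ge> 0"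
  shows "\<exists>C\<ge>1. \<forall>Q\<ge>1. real n ^ card (prime_factors Q) \<le> C * real Q powr \<theta>"
proof (cases "n = 1")
  case True
  have "1 \<le> real Q powr \<theta>" if "Q \<ge> 1" for Q :: nat
    using that \<theta> by (intro ge_one_powr_ge_zero) auto
  then show ?thesis using True by (intro exI[of _ 1]) simp
next
  case False
  with \<theta> have \<theta>: "\<theta> > 0" by simp
  define z where "z = nat \<lceil>real n powr (1 / \<theta>)\<rceil>"
  have "real n ^ card (prime_factors Q) \<le> real n ^ z * real Q powr \<theta>" if Q: "Q \<ge> 1" for Q
  proof -
    define P where "P = prime_factors Q"
    have P: "finite P" "\<And>p. p \<in> P \<Longrightarrow> prime p" by (auto simp: P_def)
    have P0: "0 \<notin> P" using P by (metis not_prime_0)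
    have pow: "real p powr \<theta> \<ge> 1" if "p \<in> P" for p
      using \<theta> prime_gt_0_nat[OF P(2)[OF that]] by (intro ge_one_powr_ge_zero) auto
    have "real n ^ card P = (\<Prod>p\<in>P. real n / real p powr \<theta>) * (\<Prod>p\<in>P. real p powr \<theta>)"
      using P0 P(1) by (simp add: prod_dividef)
    also have "(\<Prod>p\<in>P. real n / real p powr \<theta>) \<le> real n ^ z"
    proof (rule prod_le_exceptional[OF P(1) P0])
      fix p assume p: "p \<in> P"
      show "real n / real p powr \<theta> \<le> (if p \<le> z then real n else 1)"
      proof (cases "p \<le> z")
        case True
        then show ?thesis using pow[OF p] n by (simp add: divide_simps mult_le_cancel_left1)
      next
        case False
        then have "real n powr (1 / \<theta>) \<le> real p" unfolding z_def by linarith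
        then have "(real n powr (1 / \<theta>)) powr \<theta> \<le> real p powr \<theta>"
          using \<theta> by (intro powr_mono2) auto
        then show ?thesis using False \<theta> n pow[OF p] by (simp add: powr_powr divide_simps)
      qed
    qed (use n in auto)
    also have "(\<Prod>p\<in>P. real p powr \<theta>) = (real (\<Prod>P)) powr \<theta>"
      by (simp add: prod_powr_distrib)
    also have "\<dots> \<le> real Q powr \<theta>"
    proof (intro powr_mono2)
      have "\<Prod>P dvd (\<Prod>p\<in>P. p ^ multiplicity p Q)"
        using Q by (intro prod_dvd_prod) (auto simp: P_def prime_factors_multiplicity)
      also have "\<dots> = Q" using Q prime_factorization_nat[of Q] by (simp add: P_def)
      finally have "\<Prod>P \<le> Q" using Q by (intro dvd_imp_le) auto
      then show "real (\<Prod>P) \<le> real Q" by (simp only: of_nat_le_iff)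
    qed (use \<theta> in \<open>auto intro!: prod_nonneg\<close>)
    finally show ?thesis by (simp add: P_def mult_left_mono mult_right_mono prod_nonneg)
  qed
  then show ?thesis using n by (intro exI[of _ "real n ^ z"]) simp
qed

text \<open>
  A constant chosen once and for all, so that the constants of the later estimates are explicit
  expressions and those estimates need no existential quantifiers.
\<close>

definition omega_const :: "nat \<Rightarrow> real \<Rightarrow> real" where
  "omega_const n \<theta> =
    (SOME C. C \<ge> 1 \<and> (\<forall>Q\<ge>1. real n ^ card (prime_factors Q) \<le> C * real Q powr \<theta>))"

lemma
  assumes "n \<ge> 1" "\<theta> > 0 \<or> n = 1 \<and> \<theta> \<ge> 0"
  shows omega_const_ge_1: "omega_const n \<theta> \<ge> 1"
    and power_card_prime_factors_le:
      "Q \<ge> 1 \<Longrightarrow> real n ^ card (prime_factors Q) \<le> omega_const n \<theta> * real Q powr \<theta>"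
  using someI_ex[OF power_card_prime_factors_le_ex[OF assms]] unfolding omega_const_def by blast+

section \<open>The size of the denominator\<close>

lemma power_dvd_if_prime_powers:
  fixes M :: int
  assumes Q: "Q \<ge> 1" and M: "\<And>p. prime p \<Longrightarrow> int p ^ (e * multiplicity p Q) dvd M"
  shows "int Q ^ e dvd M"
proof (cases "M = 0")
  case False
  have "Q ^ e dvd nat \<bar>M\<bar>"
  proof (rule multiplicity_le_imp_dvd)
    fix p :: nat assume p: "prime p"
    have "p ^ (e * multiplicity p Q) dvd nat \<bar>M\<bar>"
    proof (subst int_dvd_int_iff[symmetric])
      show "int (p ^ (e * multiplicity p Q)) dvd int (nat \<bar>M\<bar>)" using M[OF p] by simp
    qed
    then have "e * multiplicity p Q \<le> multiplicity p (nat \<bar>M\<bar>)"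
      using False p not_prime_unit[of p] by (intro multiplicity_geI) auto
    then show "multiplicity p (Q ^ e) \<le> multiplicity p (nat \<bar>M\<bar>)"
      using p Q by (simp add: prime_elem_multiplicity_power_distrib)
  qed (use Q in auto)
  then have "int (Q ^ e) dvd int (nat \<bar>M\<bar>)" by (simp only: int_dvd_int_iff)
  then show ?thesis by simp
qed auto

lemma prime_power_dvd_vdm:
  assumes "divides_differences n Q R" "prime p" "p ^ k dvd Q" "X \<subseteq> R" "card X = Suc n"
  shows "int p ^ k dvd vdm X"
proof -
  have fin: "finite X" using assms(5) by (simp add: card_ge_0_finite)
  obtain x where x: "x \<in> X" "int p ^ k dvd (\<Prod>y\<in>X - {x}. x - y)"
    using assms unfolding divides_differences_def by blast
  then have "int p ^ k dvd (\<Prod>y\<in>X - {x}. \<bar>x - y\<bar>)"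
    by (simp flip: abs_prod)
  then show ?thesis
    by (simp add: vdm_remove[OF fin x(1)])
qed

lemma denominator_le_diameter:
  assumes dd: "divides_differences n Q R" and Q: "Q \<ge> 1" and X: "X \<subseteq> R" "card X = Suc n"
    and diam: "\<And>x y. x \<in> X \<Longrightarrow> y \<in> X \<Longrightarrow> real_of_int \<bar>x - y\<bar> \<le> B" and B: "B \<ge> 0"
  shows "real Q \<le> B ^ (Suc n choose 2)"
proof -
  have fin: "finite X" using X by (simp add: card_ge_0_finite)
  have "int Q ^ 1 dvd vdm X"
  proof (rule power_dvd_if_prime_powers[OF Q])
    fix p :: nat assume "prime p"
    then show "int p ^ (1 * multiplicity p Q) dvd vdm X"
      unfolding mult_1 by (rule prime_power_dvd_vdm[OF dd _ multiplicity_dvd X])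
  qed
  then have "int Q \<le> vdm X"
    using vdm_pos[of X] by (intro zdvd_imp_le) simp_all
  then have "real Q \<le> real_of_int (vdm X)" by linarith
  also have "\<dots> \<le> B ^ (Suc n choose 2)"
    using vdm_le[OF fin diam B] X by simp
  finally show ?thesis .
qed

lemma two_mult_choose_two: "2 * (Suc n choose 2) = n * Suc n"
  by (simp add: choose_two)

text \<open>
  The points lie in at most \<open>n\<close> classes modulo \<open>p ^ j\<close> with \<open>j = \<lceil>k / n\<rceil>\<close>. Since there are more than
  \<open>n * n\<close> of them, the pigeonhole principle puts \<open>n + 1\<close> of them in a single class.
\<close>

lemma congruent_tuple:
  fixes p :: nat
  assumes p: "prime p" "p ^ k dvd Q" and dd: "divides_differences n Q X"
    and X: "finite X" "card X = n\<^sup>2 + 1" and n: "n \<ge> 1"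
  obtains T j where "T \<subseteq> X" "card T = Suc n" "k \<le> n * j"
    "\<And>x y. x \<in> T \<Longrightarrow> y \<in> T \<Longrightarrow> int p ^ j dvd x - y"
proof (cases "k = 0")
  case True
  have "Suc n \<le> card X" using X n by (simp add: power2_eq_square)
  then obtain T where "T \<subseteq> X" "card T = Suc n" by (meson obtain_subset_with_card_n)
  then show ?thesis using that[of T 0] True by simp
next
  case False
  \<comment> \<open>Thus \<open>Suc m\<close> is \<open>k / n\<close> rounded up.\<close>
  define m where "m = (k - 1) div n"
  have m: "n * m < k" "k \<le> n * Suc m"
  proof -
    have "n * m \<le> k - 1" by (simp add: m_def)
    then show "n * m < k" using False by simp
    have "k - 1 < n * Suc m" using n by (auto simp: m_def dividend_less_times_div)
    then show "k \<le> n * Suc m" by simp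
  qed
  let ?r = "\<lambda>x. x mod int p ^ Suc m"
  have few: "card (?r ` X) \<le> n" using card_residues_le[OF p dd m(1)] .
  have "\<exists>c\<in>?r ` X. card {x \<in> X. ?r x = c} \<ge> Suc n"
  proof (rule ccontr)
    assume "\<not> ?thesis"
    then have "card X \<le> card (?r ` X) * n"
      by (intro card_le_fibres X) (auto simp: not_less_eq_eq)
    also have "\<dots> \<le> n * n" using few by simp
    finally show False using X by (simp add: power2_eq_square)
  qed
  then obtain c where "card {x \<in> X. ?r x = c} \<ge> Suc n" by blast
  then obtain T where T: "T \<subseteq> {x \<in> X. ?r x = c}" "card T = Suc n"
    by (meson obtain_subset_with_card_n)
  have "int p ^ Suc m dvd x - y" if "x \<in> T" "y \<in> T" for x y
  proof -
    have "?r x = ?r y" using T that by blast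
    then show ?thesis by (simp only: mod_eq_dvd_iff)
  qed
  then show ?thesis using that[of T "Suc m"] T m by blast
qed

text \<open>
  The Vandermonde product of every \<open>(n + 1)\<close>-tuple is divisible by \<open>Q\<close>, which alone would only give
  \<open>Q \<le> B powr (n * (n + 1) / 2)\<close>. Among \<open>n\<^sup>2 + 1\<close> points there is, for each prime, a tuple of points
  in one class, and it contributes \<open>n * (n + 1) / 2\<close> differences that are each divisible by
  \<open>p ^ \<lceil>k / n\<rceil>\<close>, hence at least \<open>(n + 1) / 2\<close> times the exponent \<open>k\<close>. Multiplying over all \<open>N\<close>
  tuples accumulates a divisor \<open>Q ^ (2 * N + 1)\<close> of the product of the squares, instead of
  \<open>Q ^ (2 * N)\<close>.
\<close>

lemma denominator_power_le_diameter:
  fixes n :: nat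
  defines "N \<equiv> (n\<^sup>2 + 1) choose Suc n"
  assumes dd: "divides_differences n Q X" and Q: "Q \<ge> 1" and X: "finite X" "card X = n\<^sup>2 + 1"
    and n: "n \<ge> 2"
    and diam: "\<And>x y. x \<in> X \<Longrightarrow> y \<in> X \<Longrightarrow> real_of_int \<bar>x - y\<bar> \<le> B" and B: "B \<ge> 0"
  shows "real Q ^ (2 * N + 1) \<le> B ^ (n * Suc n * N)"
proof -
  define F where "F = {T. T \<subseteq> X \<and> card T = Suc n}"
  have F: "finite F" "card F = N"
    using n_subsets[OF X(1), of "Suc n"] X by (auto simp: F_def N_def)
  define M where "M = (\<Prod>T\<in>F. (vdm T)\<^sup>2)"
  have "int Q ^ (2 * N + 1) dvd M"
  proof (rule power_dvd_if_prime_powers[OF Q])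
    fix p :: nat assume p: "prime p"
    define k where "k = multiplicity p Q"
    have pk: "p ^ k dvd Q" by (simp add: k_def multiplicity_dvd)
    obtain T j where T: "T \<subseteq> X" "card T = Suc n" "k \<le> n * j"
      "\<And>x y. x \<in> T \<Longrightarrow> y \<in> T \<Longrightarrow> int p ^ j dvd x - y"
      using congruent_tuple[OF p pk dd X] n by auto
    have TF: "T \<in> F" using T by (simp add: F_def)
    have "(int p ^ j) ^ (Suc n choose 2) dvd vdm T"
      using power_dvd_vdm[of T "int p ^ j"] T X finite_subset by metis
    then have "((int p ^ j) ^ (Suc n choose 2))\<^sup>2 dvd (vdm T)\<^sup>2" by (rule dvd_power_same)
    moreover have "((int p ^ j) ^ (Suc n choose 2))\<^sup>2 = int p ^ (j * (n * Suc n))"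
      by (simp only: two_mult_choose_two mult_ac flip: power_mult)
    moreover have "int p ^ (3 * k) dvd int p ^ (j * (n * Suc n))"
    proof (rule le_imp_power_dvd)
      \<comment> \<open>This is where \<open>n \<ge> 2\<close> is needed: \<open>Suc n \<ge> 3\<close> beats the exponent \<open>2\<close> of the other tuples.\<close>
      have "3 * k \<le> Suc n * (n * j)" using n T(3) by (intro mult_mono) auto
      then show "3 * k \<le> j * (n * Suc n)" by (simp only: mult_ac)
    qed
    ultimately have T3: "int p ^ (3 * k) dvd (vdm T)\<^sup>2" using dvd_trans by metis
    have "int p ^ (2 * k) dvd (vdm T')\<^sup>2" if "T' \<in> F" for T'
    proof -
      have "int p ^ k dvd vdm T'"
        using prime_power_dvd_vdm[OF dd p pk] that by (simp add: F_def)
      then have "(int p ^ k)\<^sup>2 dvd (vdm T')\<^sup>2" by (rule dvd_power_same)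
      then show ?thesis by (simp add: mult.commute flip: power_mult)
    qed
    then have "(\<Prod>T'\<in>F - {T}. int p ^ (2 * k)) dvd (\<Prod>T'\<in>F - {T}. (vdm T')\<^sup>2)"
      by (intro prod_dvd_prod) auto
    then have "int p ^ (3 * k) * (int p ^ (2 * k)) ^ (N - 1) dvd M"
      using T3 F TF unfolding M_def by (subst prod.remove[OF F(1) TF]) (auto intro: mult_dvd_mono)
    moreover have "N \<ge> 1" using F TF by (metis One_nat_def Suc_leI card_gt_0_iff empty_iff)
    then have "int p ^ (3 * k) * (int p ^ (2 * k)) ^ (N - 1) = int p ^ ((2 * N + 1) * k)"
      unfolding power_mult[symmetric] power_add[symmetric]
      by (intro arg_cong[where f = "\<lambda>e. int p ^ e"]) (cases N; simp add: algebra_simps)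
    ultimately show "int p ^ ((2 * N + 1) * multiplicity p Q) dvd M" by (simp add: k_def)
  qed
  moreover have "M > 0" unfolding M_def by (intro prod_pos ballI zero_less_power vdm_pos)
  ultimately have "int Q ^ (2 * N + 1) \<le> M" by (rule zdvd_imp_le)
  then have "real_of_int (int Q ^ (2 * N + 1)) \<le> real_of_int M" by (simp only: of_int_le_iff)
  then have "real Q ^ (2 * N + 1) \<le> real_of_int M" by simp
  also have "\<dots> = (\<Prod>T\<in>F. (real_of_int (vdm T))\<^sup>2)" by (simp add: M_def)
  also have "\<dots> \<le> (\<Prod>T\<in>F. (B ^ (Suc n choose 2))\<^sup>2)"
  proof (intro prod_mono conjI power_mono)
    fix T assume "T \<in> F"
    then have T: "T \<subseteq> X" "card T = Suc n" "finite T" using X finite_subset by (auto simp: F_def)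
    have "real_of_int (vdm T) \<le> B ^ (card T choose 2)"
      using T diam B by (intro vdm_le) auto
    then show "real_of_int (vdm T) \<le> B ^ (Suc n choose 2)" using T by simp
    show "0 \<le> real_of_int (vdm T)" using vdm_pos[of T] by simp
  qed auto
  also have "\<dots> = B ^ (n * Suc n * N)"
    using F by (simp only: prod_constant flip: power_mult)
      (simp only: two_mult_choose_two[symmetric] mult_ac)
  finally show ?thesis .
qed

text \<open>
  The amount by which the exponent \<open>n * (n + 1) / 2\<close> of the trivial bound for \<open>Q\<close> can be lowered; its
  value comes from \<open>denominator_power_le_diameter\<close>. What matters below is that it is positive for
  \<open>n \<ge> 2\<close> and leaves an exponent of at least \<open>n\<close>.
\<close>

definition gain :: "nat \<Rightarrow> real" where
  "gain n = (if n = 1 then 0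
    else real n * (real n + 1) / (2 * (2 * real ((n\<^sup>2 + 1) choose Suc n) + 1)))"

lemma gain_pos: "n \<ge> 2 \<Longrightarrow> gain n > 0"
  by (auto simp: gain_def intro!: divide_pos_pos)

lemma gain_nonneg: "gain n \<ge> 0"
  by (simp add: gain_def)

lemma gain_le:
  assumes "n \<ge> 1"
  shows "real n \<le> real n * (real n + 1) / 2 - gain n"
proof (cases "n = 1")
  case False
  then have n: "n \<ge> 2" using assms by simp
  have "(n\<^sup>2 + 1) choose Suc n > 0" using n by (simp add: power2_eq_square)
  moreover define N where "N = real ((n\<^sup>2 + 1) choose Suc n)"
  ultimately have N: "N \<ge> 1" by linarith
  have "gain n = real n * (real n + 1) / (2 * (2 * N + 1))"
    using False by (simp add: gain_def N_def)
  also have "\<dots> \<le> real n * (real n + 1) / 6"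
    using N by (intro divide_left_mono) auto
  finally have "gain n \<le> real n * (real n + 1) / 6" .
  moreover have "real n * 3 \<le> real n * (real n + 1)" using n by (intro mult_left_mono) auto
  ultimately show ?thesis by simp
qed (simp add: gain_def)

lemma denominator_le_powr_diameter:
  assumes dd: "divides_differences n Q X" and Q: "Q \<ge> 1" and X: "finite X" "card X = n\<^sup>2 + 1"
    and n: "n \<ge> 1"
    and diam: "\<And>x y. x \<in> X \<Longrightarrow> y \<in> X \<Longrightarrow> real_of_int \<bar>x - y\<bar> \<le> B" and B: "B > 0"
  shows "real Q \<le> B powr (real n * (real n + 1) / 2 - gain n)"
proof (cases "n = 1")
  case True
  then have "real Q \<le> B ^ (Suc n choose 2)"
    using X diam B by (intro denominator_le_diameter[OF dd Q, of X]) auto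
  moreover have "Suc n choose 2 = 1" using True by (simp add: choose_two)
  ultimately show ?thesis using True B by (simp add: gain_def)
next
  case False
  define N where "N = (n\<^sup>2 + 1) choose Suc n"
  define e where "e = real (2 * N + 1)"
  have e: "e > 0" by (simp add: e_def)
  have "real Q ^ (2 * N + 1) \<le> B ^ (n * Suc n * N)"
    unfolding N_def using False n B by (intro denominator_power_le_diameter[OF dd Q X _ diam]) auto
  then have "real Q powr e \<le> B powr (real (n * Suc n * N))"
    using Q B unfolding e_def by (subst (1 2) powr_realpow) auto
  then have "(real Q powr e) powr (1 / e) \<le> (B powr (real (n * Suc n * N))) powr (1 / e)"
    using e by (intro powr_mono2) auto
  then have "real Q \<le> B powr (real (n * Suc n * N) / e)"
    using Q e by (simp add: powr_powr)
  also have "real (n * Suc n * N) / e = real n * (real n + 1) / 2 - gain n"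
  proof -
    have e': "e = 2 * real N + 1" by (simp add: e_def)
    have "gain n = real n * (real n + 1) / (2 * e)"
      using False by (simp add: gain_def e' N_def)
    then show ?thesis using e by (simp add: divide_simps e') (simp add: algebra_simps)
  qed
  finally show ?thesis .
qed

section \<open>Well spaced points\<close>

lemma obtain_least_elements:
  fixes A :: "'a :: linorder set"
  assumes "finite A" "j \<le> card A"
  obtains L where "L \<subseteq> A" "card L = j" "\<And>x y. x \<in> L \<Longrightarrow> y \<in> A - L \<Longrightarrow> x < y"
proof -
  have "\<exists>L\<subseteq>A. card L = j \<and> (\<forall>x\<in>L. \<forall>y\<in>A - L. x < y)"
    using assms(2)
  proof (induction j)
    case (Suc j)
    then obtain L where L: "L \<subseteq> A" "card L = j" "\<And>x y. x \<in> L \<Longrightarrow> y \<in> A - L \<Longrightarrow> x < y"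
      by auto
    have finL: "finite L" using L assms finite_subset by blast
    have ne: "A - L \<noteq> {}"
    proof
      assume "A - L = {}"
      then have "card A \<le> card L" using finL by (simp add: card_mono)
      then show False using Suc L by simp
    qed
    define a where "a = Min (A - L)"
    have a: "a \<in> A - L" "\<And>y. y \<in> A - L \<Longrightarrow> a \<le> y"
      using ne assms by (auto simp: a_def simp del: Diff_iff)
    have "insert a L \<subseteq> A \<and> card (insert a L) = Suc j
        \<and> (\<forall>x\<in>insert a L. \<forall>y\<in>A - insert a L. x < y)"
      using L a finL by (auto simp: order_less_le)
    then show ?case by blast
  qed auto
  then show ?thesis using that by blast
qed

text \<open>
  Take every \<open>j\<close>-th point: between two consecutive choices there is a full window of \<open>j + 1\<close> points,
  which has length at least \<open>b\<close>. The induction splits off the \<open>j\<close> smallest points.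
\<close>

lemma obtain_spaced_subset:
  assumes "finite R" "Suc (n * j) \<le> card R" "j \<ge> 1"
    and wide: "\<And>Y. Y \<subseteq> R \<Longrightarrow> card Y = Suc j \<Longrightarrow> \<exists>x\<in>Y. \<exists>y\<in>Y. b \<le> real_of_int \<bar>x - y\<bar>"
  obtains X where "X \<subseteq> R" "card X = Suc n"
    "\<And>x y. x \<in> X \<Longrightarrow> y \<in> X \<Longrightarrow> x \<noteq> y \<Longrightarrow> b \<le> real_of_int \<bar>x - y\<bar>"
proof -
  have "\<exists>X\<subseteq>R. card X = Suc n \<and> (\<forall>x\<in>X. \<forall>y\<in>X. x \<noteq> y \<longrightarrow> b \<le> real_of_int \<bar>x - y\<bar>)"
    using assms
  proof (induction n arbitrary: R)
    case 0
    then obtain x where "x \<in> R" by fastforce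
    then show ?case by (intro exI[of _ "{x}"]) auto
  next
    case (Suc n)
    obtain L where L: "L \<subseteq> R" "card L = j" "\<And>x y. x \<in> L \<Longrightarrow> y \<in> R - L \<Longrightarrow> x < y"
      using obtain_least_elements[OF Suc.prems(1), of j] Suc.prems(2) by auto
    have finL: "finite L" using L(1) Suc.prems(1) by (rule finite_subset)
    have cardRL: "Suc (n * j) \<le> card (R - L)"
      using Suc.prems(2) L finL by (simp add: card_Diff_subset)
    obtain X where X: "X \<subseteq> R - L" "card X = Suc n"
      "\<And>x y. x \<in> X \<Longrightarrow> y \<in> X \<Longrightarrow> x \<noteq> y \<Longrightarrow> b \<le> real_of_int \<bar>x - y\<bar>"
    proof -
      have "\<exists>x\<in>Y. \<exists>y\<in>Y. b \<le> real_of_int \<bar>x - y\<bar>" if "Y \<subseteq> R - L" "card Y = Suc j" for Y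
        using Suc.prems(4) that by blast
      then have "\<exists>X\<subseteq>R - L. card X = Suc n \<and> (\<forall>x\<in>X. \<forall>y\<in>X. x \<noteq> y \<longrightarrow> b \<le> real_of_int \<bar>x - y\<bar>)"
        using Suc.prems(1,3) cardRL by (intro Suc.IH) simp_all
      then show ?thesis using that by blast
    qed
    have "R - L \<noteq> {}"
    proof
      assume "R - L = {}"
      then have "card (R - L) = 0" by (simp only: card.empty)
      then show False using cardRL by linarith
    qed
    with Suc.prems(1) have RL: "finite (R - L)" "R - L \<noteq> {}" by auto
    have Lne: "L \<noteq> {}" using L Suc.prems(3) by auto
    define r where "r = Min (R - L)"
    define a where "a = Min L"
    have r: "r \<in> R - L" "\<And>y. y \<in> R - L \<Longrightarrow> r \<le> y"
      using RL by (auto simp: r_def simp del: Diff_iff)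
    have a: "a \<in> L" "\<And>y. y \<in> L \<Longrightarrow> a \<le> y"
      using finL Lne by (auto simp: a_def)
    have "\<exists>x\<in>insert r L. \<exists>y\<in>insert r L. b \<le> real_of_int \<bar>x - y\<bar>"
      using L r finL by (intro Suc.prems(4)) auto
    then obtain x y where xy: "x \<in> insert r L" "y \<in> insert r L" "b \<le> real_of_int \<bar>x - y\<bar>" by blast
    have "a \<le> z \<and> z \<le> r" if "z \<in> insert r L" for z
      using that a L(3)[OF _ r(1)] by (auto intro: less_imp_le)
    then have "b \<le> real_of_int (r - a)" using xy by (smt (verit) of_int_le_iff)
    then have far: "b \<le> real_of_int \<bar>z - a\<bar>" if "z \<in> X" for z
      using r(2)[of z] X(1) that by (smt (verit) of_int_le_iff subsetD)
    have "a \<notin> X" using a X by auto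
    moreover have "finite X" using X RL finite_subset by blast
    ultimately have "card (insert a X) = Suc (Suc n)" using X by simp
    moreover have "insert a X \<subseteq> R" using a L X by auto
    moreover have "\<forall>x\<in>insert a X. \<forall>y\<in>insert a X. x \<noteq> y \<longrightarrow> b \<le> real_of_int \<bar>x - y\<bar>"
      using far X(3) by (auto simp: abs_minus_commute)
    ultimately show ?case by blast
  qed
  then show ?thesis using that by blast
qed

text \<open>
  The Vandermonde product of the nodes times \<open>P w - y w\<close> is an integer: up to sign it is the
  determinant with rows \<open>(1, x, \<dots>, x ^ n, y x)\<close> over \<open>insert w X\<close>. The polynomial \<open>f\<close> itself
  contributes nothing to that determinant, so its size is governed by the errors \<open>\<delta>\<close> times Vandermonde
  products of \<open>n + 1\<close> points.
\<close>

lemma near_points_lie_on_lagrange: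
  fixes y :: "int \<Rightarrow> int"
  assumes X: "card X = Suc n" and w: "w \<notin> X" and f: "degree f \<le> n"
    and close: "\<And>x. x \<in> insert w X \<Longrightarrow> \<bar>poly f (of_int x) - of_int (y x)\<bar> \<le> \<delta>"
    and diam: "\<And>x x'. x \<in> insert w X \<Longrightarrow> x' \<in> insert w X \<Longrightarrow> real_of_int \<bar>x - x'\<bar> \<le> B"
    and small: "(real n + 2) * \<delta> * B ^ (Suc n choose 2) < 1"
  shows "poly (lagrange X (\<lambda>x. of_int (y x))) (of_int w) = of_int (y w)"
proof -
  have fin: "finite X" using X by (simp add: card_ge_0_finite)
  have B: "B \<ge> 0" using diam[of w w] by simp
  have \<delta>: "\<delta> \<ge> 0" using close[of w] by simp
  let ?P = "lagrange X (\<lambda>x. of_int (y x))"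
  let ?V = "real_of_int (vdm X)"
  let ?l = "\<lambda>x. (\<Prod>z\<in>X - {x}. real_of_int w - of_int z) / (\<Prod>z\<in>X - {x}. of_int (x - z))"
  have V: "?V > 0" using vdm_pos by simp
  have V_eq: "?V = real_of_int (vdm (X - {x})) * \<bar>\<Prod>z\<in>X - {x}. real_of_int (x - z)\<bar>" if "x \<in> X" for x
    using vdm_remove[OF fin that] by (simp add: abs_prod)
  have nz: "(\<Prod>z\<in>X - {x}. real_of_int (x - z)) \<noteq> 0" for x using fin by auto
  have Vl: "?V * \<bar>?l x\<bar> \<le> B ^ (Suc n choose 2)" if x: "x \<in> X" for x
  proof -
    have "?V * \<bar>?l x\<bar> = real_of_int (vdm (X - {x})) * \<bar>\<Prod>z\<in>X - {x}. real_of_int w - of_int z\<bar>"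
      using nz[of x] by (simp add: V_eq[OF x] abs_divide)
    also have "\<dots> = real_of_int (vdm (insert w (X - {x})))"
      using fin w by (subst vdm_insert) (auto simp: abs_prod)
    also have "\<dots> \<le> B ^ (card (insert w (X - {x})) choose 2)"
      using fin diam B by (intro vdm_le) auto
    also have "card (insert w (X - {x})) = Suc n"
      using fin w X x by simp
    finally show ?thesis .
  qed
  have "?V * (of_int (y x) * ?l x) \<in> \<int>" if x: "x \<in> X" for x
  proof -
    have "?V * (of_int (y x) * ?l x) = real_of_int (vdm (X - {x})) * of_int (y x)
        * (\<Prod>z\<in>X - {x}. of_int w - of_int z) * sgn (\<Prod>z\<in>X - {x}. real_of_int (x - z))"
      unfolding V_eq[OF x] using nz[of x] by (simp add: abs_sgn field_simps)
    also have "\<dots> \<in> \<int>" by (auto simp: sgn_if intro!: Ints_mult Ints_prod)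
    finally show ?thesis .
  qed
  then have "(\<Sum>x\<in>X. ?V * (of_int (y x) * ?l x)) \<in> \<int>" by (rule Ints_sum)
  then have "?V * poly ?P (of_int w) \<in> \<int>"
    by (simp add: poly_lagrange sum_distrib_left)
  then have int: "?V * (poly ?P (of_int w) - of_int (y w)) \<in> \<int>"
    by (auto simp: right_diff_distrib)
  have Pw: "poly ?P (of_int w) = (\<Sum>x\<in>X. of_int (y x) * ?l x)"
    by (simp add: poly_lagrange)
  have fw: "poly f (of_int w) = (\<Sum>x\<in>X. poly f (of_int x) * ?l x)"
    using lagrange_self[OF X f] poly_lagrange[of X "\<lambda>x. poly f (of_int x)" "of_int w"] by simp
  have "(\<Sum>x\<in>X. (of_int (y x) - poly f (of_int x)) * ?l x)
      = (\<Sum>x\<in>X. of_int (y x) * ?l x) - (\<Sum>x\<in>X. poly f (of_int x) * ?l x)"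
    by (simp only: left_diff_distrib sum_subtractf)
  then have "poly ?P (of_int w) - of_int (y w)
      = (\<Sum>x\<in>X. (of_int (y x) - poly f (of_int x)) * ?l x) + (poly f (of_int w) - of_int (y w))"
    using Pw fw by linarith
  then have eq: "?V * (poly ?P (of_int w) - of_int (y w))
      = (\<Sum>x\<in>X. (of_int (y x) - poly f (of_int x)) * (?V * ?l x)) + ?V * (poly f (of_int w) - of_int (y w))"
    by (simp only: distrib_left sum_distrib_left mult_ac)
  have "\<bar>?V * (poly ?P (of_int w) - of_int (y w))\<bar>
      \<le> (\<Sum>x\<in>X. \<bar>(of_int (y x) - poly f (of_int x)) * (?V * ?l x)\<bar>) + \<bar>?V * (poly f (of_int w) - of_int (y w))\<bar>"
    unfolding eq by (rule order.trans[OF abs_triangle_ineq add_right_mono[OF sum_abs]])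
  also have "\<dots> \<le> (\<Sum>x\<in>X. \<delta> * B ^ (Suc n choose 2)) + B ^ (Suc n choose 2) * \<delta>"
  proof (intro add_mono sum_mono)
    fix x assume x: "x \<in> X"
    have "\<bar>of_int (y x) - poly f (of_int x)\<bar> \<le> \<delta>" using close[of x] x by (simp add: abs_minus_commute)
    moreover have "\<bar>?V * ?l x\<bar> \<le> B ^ (Suc n choose 2)" using Vl[OF x] V by (simp add: abs_mult)
    ultimately show "\<bar>(of_int (y x) - poly f (of_int x)) * (?V * ?l x)\<bar> \<le> \<delta> * B ^ (Suc n choose 2)"
      unfolding abs_mult using \<delta> by (intro mult_mono) auto
  next
    have "?V \<le> B ^ (Suc n choose 2)" using vdm_le[OF fin _ B] diam X by auto
    then show "\<bar>?V * (poly f (of_int w) - of_int (y w))\<bar> \<le> B ^ (Suc n choose 2) * \<delta>"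
      unfolding abs_mult using V close[of w] B by (intro mult_mono) auto
  qed
  also have "\<dots> = (real n + 2) * \<delta> * B ^ (Suc n choose 2)"
    using X by (simp add: algebra_simps)
  also have "\<dots> < 1" using small .
  finally have "?V * (poly ?P (of_int w) - of_int (y w)) = 0"
    using int by (meson Ints_nonzero_abs_less1)
  then show ?thesis using V by simp
qed

lemma spaced_interpolation_bounds:
  assumes X: "card X = Suc n" and g: "degree g \<le> n" and b: "b > 0"
    and spaced: "\<And>x y. x \<in> X \<Longrightarrow> y \<in> X \<Longrightarrow> x \<noteq> y \<Longrightarrow> b \<le> real_of_int \<bar>x - y\<bar>"
    and small: "\<And>x. x \<in> X \<Longrightarrow> \<bar>poly g (of_int x)\<bar> \<le> \<delta>"
  shows "\<bar>coeff g n\<bar> \<le> (real n + 1) * \<delta> / b ^ n"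
    and "(\<And>x. x \<in> X \<Longrightarrow> \<bar>z - of_int x\<bar> \<le> l) \<Longrightarrow> \<bar>poly g z\<bar> \<le> (real n + 1) * \<delta> * (l / b) ^ n"
proof -
  have fin: "finite X" using X by (simp add: card_ge_0_finite)
  let ?d = "\<lambda>x. \<Prod>y\<in>X - {x}. real_of_int (x - y)"
  have d: "b ^ n \<le> \<bar>?d x\<bar>" if "x \<in> X" for x
  proof -
    have "(\<Prod>y\<in>X - {x}. b) \<le> (\<Prod>y\<in>X - {x}. \<bar>real_of_int (x - y)\<bar>)"
    proof (intro prod_mono conjI)
      fix y assume "y \<in> X - {x}"
      then have "b \<le> real_of_int \<bar>x - y\<bar>" using spaced that by blast
      then show "b \<le> \<bar>real_of_int (x - y)\<bar>" by simp
    qed (use b in auto)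
    then show ?thesis using that fin X by (simp add: abs_prod)
  qed
  have \<delta>: "\<delta> \<ge> 0" using small X by (metis abs_ge_zero card.empty equals0I nat.distinct(1) order_trans)
  have self: "lagrange X (\<lambda>x. poly g (of_int x)) = g" using lagrange_self[OF X g] .
  have "coeff g n = (\<Sum>x\<in>X. poly g (of_int x) / ?d x)"
    using coeff_lagrange[OF X, of "\<lambda>x. poly g (of_int x)"] self by simp
  also have "\<bar>\<dots>\<bar> \<le> (\<Sum>x\<in>X. \<delta> / b ^ n)"
  proof (intro order.trans[OF sum_abs] sum_mono)
    fix x assume "x \<in> X"
    then show "\<bar>poly g (of_int x) / ?d x\<bar> \<le> \<delta> / b ^ n"
      unfolding abs_divide using d small b \<delta> by (intro frac_le) auto
  qed
  finally show "\<bar>coeff g n\<bar> \<le> (real n + 1) * \<delta> / b ^ n"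
    using X by (simp add: algebra_simps)
  assume l: "\<And>x. x \<in> X \<Longrightarrow> \<bar>z - of_int x\<bar> \<le> l"
  have "poly g z = (\<Sum>x\<in>X. poly g (of_int x) * (\<Prod>y\<in>X - {x}. z - of_int y) / ?d x)"
    using poly_lagrange[of X "\<lambda>x. poly g (of_int x)" z] self by simp
  also have "\<bar>\<dots>\<bar> \<le> (\<Sum>x\<in>X. \<delta> * l ^ n / b ^ n)"
  proof (intro order.trans[OF sum_abs] sum_mono)
    fix x assume x: "x \<in> X"
    have "\<bar>\<Prod>y\<in>X - {x}. z - of_int y\<bar> \<le> (\<Prod>y\<in>X - {x}. l)"
      unfolding abs_prod using l by (intro prod_mono) auto
    then have "\<bar>\<Prod>y\<in>X - {x}. z - of_int y\<bar> \<le> l ^ n" using x fin X by simp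
    then show "\<bar>poly g (of_int x) * (\<Prod>y\<in>X - {x}. z - of_int y) / ?d x\<bar> \<le> \<delta> * l ^ n / b ^ n"
      unfolding abs_divide abs_mult using d[OF x] small[OF x] b \<delta>
      by (intro frac_le mult_mono) auto
  qed
  finally show "\<bar>poly g z\<bar> \<le> (real n + 1) * \<delta> * (l / b) ^ n"
    using X by (simp add: algebra_simps power_divide)
qed

text \<open>
  With \<open>M\<close> points, the spacing \<open>M * Q powr (1 / n) / spread n\<close> is attained. The constant comes from the
  density bound with its constant \<open>n ^ (n ^ n)\<close>, applied to windows of about \<open>M / n\<close> points.
\<close>

definition spread :: "nat \<Rightarrow> real" where
  "spread n = 2 * real n * real n ^ (n ^ n)"

lemma spread_pos: "n \<ge> 1 \<Longrightarrow> spread n > 0"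
  by (simp add: spread_def)

text \<open>
  If \<open>R\<close> is so large that the second term of \<open>card_le_density\<close> is negligible, then already a window
  containing a fraction \<open>1 / n\<close> of its points must be about \<open>M * Q powr (1 / n)\<close> long. The factor
  \<open>Q powr (1 / n)\<close> will cancel the denominators \<open>Q\<close> in the applications.
\<close>

lemma obtain_spread_points:
  assumes R: "finite R" and Q: "Q \<ge> 1" and dd: "divides_differences n Q R" and n: "n \<ge> 1"
    and large: "4 * real n * real n ^ card (prime_factors Q) \<le> real (card R)"
  obtains X where "X \<subseteq> R" "card X = Suc n"
    "\<And>x y. x \<in> X \<Longrightarrow> y \<in> X \<Longrightarrow> x \<noteq> y \<Longrightarrow>
      real (card R) * real Q powr (1 / real n) / spread n \<le> real_of_int \<bar>x - y\<bar>"
proof -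
  define M where "M = card R"
  define j where "j = (M - 1) div n"
  define E where "E = real n ^ card (prime_factors Q)"
  define c where "c = real n ^ (n ^ n)"
  have c: "c > 0" using n by (simp add: c_def)
  have E: "E \<ge> 1" using n by (simp add: E_def)
  have "4 * real n * 1 \<le> 4 * real n * E" using E by (intro mult_left_mono) auto
  then have "4 * n \<le> M" using large by (simp add: E_def M_def)
  then have Mn: "n < M" using n by simp
  have "n * j \<le> M - 1" by (simp add: j_def)
  then have le: "Suc (n * j) \<le> M" using Mn by simp
  have "M - 1 < n * Suc j" using n by (auto simp: j_def dividend_less_times_div)
  then have "M \<le> n * Suc j" by simp
  then have "real M \<le> real (n * Suc j)" by (simp only: of_nat_le_iff)
  then have Mj: "real M / real n \<le> real (Suc j)"
    using n by (simp add: pos_divide_le_eq algebra_simps)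
  have j: "j \<ge> 1"
    using Mn n by (simp add: j_def div_greater_zero_iff Suc_le_eq)
  have wide: "\<exists>x\<in>Y. \<exists>y\<in>Y. real M * real Q powr (1 / real n) / spread n \<le> real_of_int \<bar>x - y\<bar>"
    if Y: "Y \<subseteq> R" "card Y = Suc j" for Y
  proof -
    have fin: "finite Y" using Y by (simp add: card_ge_0_finite)
    have ne: "Y \<noteq> {}" using Y by auto
    define h where "h = real_of_int (Max Y - Min Y)"
    have h: "real_of_int \<bar>x - y\<bar> \<le> h" if "x \<in> Y" "y \<in> Y" for x y
      unfolding h_def of_int_le_iff
      using Max_ge[OF fin that(1)] Max_ge[OF fin that(2)] Min_le[OF fin that(1)] Min_le[OF fin that(2)]
      by linarith
    have h0: "h \<ge> 0" using h ne by fastforce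
    have "real (Suc j) \<le> c * h * real Q powr (- (1 / real n)) + E"
      using card_le_density[OF fin Q divides_differences_subset[OF dd Y(1)] n h0 h] Y(2)
      by (simp add: E_def c_def)
    moreover have "E \<le> real M / (2 * real n)"
      using large n E by (simp add: E_def M_def field_simps)
    moreover have "real M / real n = 2 * (real M / (2 * real n))" by simp
    ultimately have "real M / (2 * real n) \<le> c * h * real Q powr (- (1 / real n))"
      using Mj by linarith
    then have "real M / (2 * real n) * real Q powr (1 / real n)
        \<le> c * h * real Q powr (- (1 / real n)) * real Q powr (1 / real n)"
      by (intro mult_right_mono) auto
    also have "\<dots> = c * h" using Q by (simp add: powr_minus)
    finally have "real M * real Q powr (1 / real n) / spread n \<le> h"
      using n c by (simp add: spread_def field_simps flip: c_def)
    moreover have "real_of_int \<bar>Max Y - Min Y\<bar> = h"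
      using fin ne by (simp add: h_def)
    ultimately show ?thesis using fin ne Max_in Min_in by metis
  qed
  show thesis
    using obtain_spaced_subset[OF R le[unfolded M_def] j wide] that unfolding M_def by blast
qed

section \<open>Runs of points on a common curve\<close>

text \<open>
  The value \<open>P w - y w\<close> is a nonzero rational number with denominator dividing \<open>Q\<close>, hence at least
  \<open>1 / Q\<close>. On the other hand \<open>P - f\<close> is at most \<open>\<delta>\<close> at \<open>n + 1\<close> points of spacing \<open>b\<close>, and extrapolation to
  \<open>w\<close> costs a factor \<open>(l / b) ^ n\<close>.
\<close>

lemma off_curve_spacing:
  fixes y :: "int \<Rightarrow> int"
  assumes f: "degree f \<le> n" and P: "degree P \<le> n" and n: "n \<ge> 1"
    and Q: "Q \<ge> 1" "integral_poly (smult (of_nat Q) P)"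
    and X: "card X = Suc n"
    and on: "\<And>x. x \<in> X \<Longrightarrow> poly P (of_int x) = of_int (y x)"
    and close: "\<And>x. x \<in> X \<Longrightarrow> \<bar>poly f (of_int x) - of_int (y x)\<bar> \<le> \<delta>"
    and b: "b > 0" and spaced: "\<And>x x'. x \<in> X \<Longrightarrow> x' \<in> X \<Longrightarrow> x \<noteq> x' \<Longrightarrow> b \<le> real_of_int \<bar>x - x'\<bar>"
    and diam: "\<And>x x'. x \<in> insert w X \<Longrightarrow> x' \<in> X \<Longrightarrow> real_of_int \<bar>x - x'\<bar> \<le> l"
    and w: "\<bar>poly f (of_int w) - of_int (y w)\<bar> \<le> \<delta>" "poly P (of_int w) \<noteq> of_int (y w)"
  shows "b ^ n \<le> (real n + 2) * \<delta> * real Q * l ^ n"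
proof -
  have \<delta>: "\<delta> \<ge> 0" using w(1) by linarith
  have "b \<le> l"
  proof -
    have "finite X" "\<not> card X \<le> Suc 0" using X n by (auto simp: card_ge_0_finite)
    then obtain x x' where x: "x \<in> X" "x' \<in> X" "x \<noteq> x'"
      by (auto simp: card_le_Suc0_iff_eq)
    show ?thesis using spaced[OF x] diam[OF insertI2[OF x(1)] x(2)] by (rule order.trans)
  qed
  then have ratio: "l / b \<ge> 1" using b by simp
  have "\<bar>poly (P - f) (of_int w)\<bar> \<le> (real n + 1) * \<delta> * (l / b) ^ n"
  proof (rule spaced_interpolation_bounds(2)[OF X _ b spaced])
    show "degree (P - f) \<le> n" using P f by (rule degree_diff_le)
    show "\<bar>poly (P - f) (of_int x)\<bar> \<le> \<delta>" if "x \<in> X" for x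
      using on[OF that] close[OF that] by (simp add: abs_minus_commute)
    show "\<bar>real_of_int w - of_int x\<bar> \<le> l" if "x \<in> X" for x
      using diam[of w x] that by simp
  qed
  moreover have "\<bar>poly P (of_int w) - of_int (y w)\<bar>
      \<le> \<bar>poly (P - f) (of_int w)\<bar> + \<bar>poly f (of_int w) - of_int (y w)\<bar>" by simp
  moreover have "1 * \<delta> \<le> (l / b) ^ n * \<delta>"
    using \<delta> ratio by (intro mult_right_mono one_le_power) auto
  ultimately have up: "\<bar>poly P (of_int w) - of_int (y w)\<bar> \<le> (real n + 2) * \<delta> * (l / b) ^ n"
    using w(1) by (simp add: algebra_simps)
  have "real Q * poly P (of_int w) \<in> \<int>" using integral_poly_poly[OF Q(2)] by simp
  then have "real Q * (poly P (of_int w) - of_int (y w)) \<in> \<int>" by (auto simp: right_diff_distrib)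
  then have "1 \<le> \<bar>real Q * (poly P (of_int w) - of_int (y w))\<bar>"
    using w(2) Q(1) by (intro Ints_nonzero_abs_ge1) auto
  also have "\<dots> \<le> real Q * ((real n + 2) * \<delta> * (l / b) ^ n)"
    using up by (simp add: abs_mult mult_left_mono)
  finally have "b ^ n * 1 \<le> b ^ n * (real Q * ((real n + 2) * \<delta> * (l / b) ^ n))"
    using b by (intro mult_left_mono) auto
  also have "\<dots> = (real n + 2) * \<delta> * real Q * (b * (l / b)) ^ n"
    by (simp only: power_mult_distrib mult_ac)
  finally show ?thesis using b by simp
qed

definition run_const :: "nat \<Rightarrow> real" where
  "run_const n = 4 * real n
      * omega_const n (gain n / (real n + gain n) / real (Suc n choose 2)) + spread n"

text \<open>
  A run of points on one curve \<open>P\<close> that is followed by a point \<open>w\<close> off the curve has density at most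
  about \<open>1 / L\<close>, where \<open>L\<close> is of order \<open>\<delta> powr (- 2 / (n * (n + 1)))\<close>. There are two cases.

  If the run is large compared with \<open>n\<close> to the number of prime divisors of \<open>Q\<close>, it contains points of
  spacing \<open>M * Q powr (1 / n)\<close>. In \<open>off_curve_spacing\<close> the denominators cancel, and
  \<open>M \<le> C * \<delta> powr (1 / n) * l\<close>, which is at least as strong as needed.

  Otherwise the run is bounded by a constant times any given positive power of \<open>l\<close>, or by a constant
  if \<open>n = 1\<close>, and it suffices to know that \<open>l\<close> exceeds \<open>L\<close> by a power of \<open>L\<close>, or that \<open>l \<ge> L\<close> if
  \<open>n = 1\<close>. Here the cluster \<open>T\<close> at the start of the run comes in. Let \<open>B\<close> be the length of its
  shortest window of \<open>n\<^sup>2 + 1\<close> points; \<open>n\<close> such windows fit into \<open>T\<close>, so \<open>T\<close> has \<open>n + 1\<close> points of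
  spacing \<open>B\<close>. By \<open>off_curve_spacing\<close>, \<open>(l / B) ^ n\<close> is at least of order \<open>1 / (\<delta> * Q)\<close>, while
  \<open>Q \<le> B powr (n * (n + 1) / 2 - gain n)\<close>; together they give \<open>L powr (n + gain n) \<le> l ^ n\<close>.
\<close>

lemma card_run_le:
  fixes f P :: "real poly" and y :: "int \<Rightarrow> int" and \<delta> l L :: real
  assumes n: "n \<ge> 1" and f: "degree f \<le> n" and P: "degree P \<le> n" and R: "finite R"
    and on: "\<And>x. x \<in> R \<Longrightarrow> poly P (of_int x) = of_int (y x)"
    and close: "\<And>x. x \<in> insert w R \<Longrightarrow> \<bar>poly f (of_int x) - of_int (y x)\<bar> \<le> \<delta>"
    and off: "poly P (of_int w) \<noteq> of_int (y w)"
    and diam: "\<And>x x'. x \<in> insert w R \<Longrightarrow> x' \<in> R \<Longrightarrow> real_of_int \<bar>x - x'\<bar> \<le> l"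
    and T: "T \<subseteq> R" "card T = Suc (n * n\<^sup>2)"
    and Tdiam: "\<And>x x'. x \<in> T \<Longrightarrow> x' \<in> T \<Longrightarrow> real_of_int \<bar>x - x'\<bar> \<le> L"
    and L0: "L > 0" and L: "2 * (real n + 2) * \<delta> * L powr (real n * (real n + 1) / 2) = 1"
  shows "real (card R) \<le> run_const n * (l / L)"
proof -
  define \<theta> where "\<theta> = gain n / (real n + gain n)"
  define d where "d = real (Suc n choose 2)"
  have d: "d > 0" using n by (simp add: d_def)
  have d_eq: "d = real n * (real n + 1) / 2"
  proof -
    have "2 * d = real (2 * (Suc n choose 2))" by (simp add: d_def)
    then show ?thesis unfolding two_mult_choose_two by (simp add: algebra_simps)
  qed
  have g0: "gain n \<ge> 0" by (rule gain_nonneg)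
  have "\<theta> / d > 0 \<or> n = 1 \<and> \<theta> / d \<ge> 0"
  proof (cases "n = 1")
    case False
    then have "gain n > 0" using n gain_pos[of n] by simp
    then show ?thesis using d n by (simp add: \<theta>_def)
  qed (use d g0 in \<open>simp add: \<theta>_def\<close>)
  note omega = omega_const_ge_1[OF n this] power_card_prime_factors_le[OF n this]
  define C where "C = omega_const n (\<theta> / d)"
  have C: "C \<ge> 1" using omega(1) by (simp add: C_def)
  have K: "run_const n = 4 * real n * C + spread n"
    by (simp add: run_const_def C_def \<theta>_def d_def)
  have finT: "finite T" using T R finite_subset by blast
  have "Suc n \<le> card T" using T n by simp
  then have cardR: "Suc n \<le> card R" using card_mono[OF R T(1)] by simp
  obtain Q where Q: "Q \<ge> 1" "integral_poly (smult (of_nat Q) P)" and dd: "divides_differences n Q R"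
    using denominator_exists[OF R cardR P] on by (metis Ints_of_int)
  have spacing: "b ^ n \<le> (real n + 2) * \<delta> * real Q * l ^ n"
    if "X \<subseteq> R" "card X = Suc n" "b > 0"
      "\<And>x x'. x \<in> X \<Longrightarrow> x' \<in> X \<Longrightarrow> x \<noteq> x' \<Longrightarrow> b \<le> real_of_int \<bar>x - x'\<bar>" for X b
  proof (rule off_curve_spacing[OF f P n Q that(2) _ _ that(3,4), where y = y and w = w])
    show "poly P (of_int x) = of_int (y x)" if "x \<in> X" for x using on that \<open>X \<subseteq> R\<close> by blast
    show "\<bar>poly f (of_int x) - of_int (y x)\<bar> \<le> \<delta>" if "x \<in> X" for x
      using close that \<open>X \<subseteq> R\<close> by blast
    show "real_of_int \<bar>x - x'\<bar> \<le> l" if "x \<in> insert w X" "x' \<in> X" for x x'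
      using diam[of x x'] that \<open>X \<subseteq> R\<close> by blast
    show "\<bar>poly f (of_int w) - of_int (y w)\<bar> \<le> \<delta>" using close by blast
  qed (use off in auto)
  have \<delta>: "(real n + 2) * \<delta> = 1 / (2 * L powr d)"
    using L L0 unfolding d_eq[symmetric] by (simp add: field_simps)

  \<comment> \<open>All sets of \<open>n\<^sup>2 + 1\<close> points of \<open>T\<close>, the number for which the improved bound on \<open>Q\<close> holds.\<close>
  define F where "F = {Y. Y \<subseteq> T \<and> card Y = Suc (n\<^sup>2)}"
  have finF: "finite F" using finT by (simp add: F_def)
  have "Suc (n\<^sup>2) \<le> card T" using T n by simp
  then obtain Y0 where "Y0 \<subseteq> T" "card Y0 = Suc (n\<^sup>2)"
    by (rule obtain_subset_with_card_n)
  then have neF: "F \<noteq> {}" by (auto simp: F_def)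
  \<comment> \<open>A shortest window: it bounds \<open>Q\<close> from above, and every other window is at least as long.\<close>
  define Y where "Y = arg_min_on (\<lambda>Y. Max Y - Min Y) F"
  have Y: "Y \<subseteq> T" "card Y = Suc (n\<^sup>2)" "\<And>Z. Z \<in> F \<Longrightarrow> Max Y - Min Y \<le> Max Z - Min Z"
    using arg_min_if_finite[OF finF neF, of "\<lambda>Y. Max Y - Min Y"]
    by (auto simp: Y_def F_def not_less)
  define B where "B = real_of_int (Max Y - Min Y)"
  have finY: "finite Y" and neY: "Y \<noteq> {}" using Y(2) by (auto simp: card_ge_0_finite)
  have Yrange: "Min Y \<le> x" "x \<le> Max Y" if "x \<in> Y" for x using finY that by auto
  have "Min Y \<noteq> Max Y"
  proof
    assume "Min Y = Max Y"
    then have "Y \<subseteq> {Max Y}" using Yrange by force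
    then have "card Y \<le> 1" using card_mono[of "{Max Y}" Y] by simp
    then show False using Y(2) n by simp
  qed
  then have B1: "B \<ge> 1" using Yrange(1)[OF Max_in[OF finY neY]] by (simp add: B_def)
  have extreme: "Max Y \<in> T" "Min Y \<in> T"
    using Y(1) Max_in[OF finY neY] Min_in[OF finY neY] by auto
  have B_eq: "real_of_int \<bar>Max Y - Min Y\<bar> = B"
    using Yrange(1)[OF Max_in[OF finY neY]] by (simp add: B_def)
  have BL: "B \<le> L"
    using Tdiam[OF extreme] unfolding B_eq .
  then have L1: "L \<ge> 1" using B1 by simp
  have QB: "real Q \<le> B powr (real n * (real n + 1) / 2 - gain n)"
  proof (rule denominator_le_powr_diameter[OF divides_differences_subset[OF dd] Q(1) finY _ n])
    show "Y \<subseteq> R" using Y T by blast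
    show "card Y = n\<^sup>2 + 1" using Y by simp
    show "real_of_int \<bar>x - x'\<bar> \<le> B" if "x \<in> Y" "x' \<in> Y" for x x'
      unfolding B_def of_int_le_iff using Yrange[OF that(1)] Yrange[OF that(2)] by linarith
  qed (use B1 in auto)
  have wide: "\<exists>x\<in>Z. \<exists>y\<in>Z. B \<le> real_of_int \<bar>x - y\<bar>" if Z: "Z \<subseteq> T" "card Z = Suc (n\<^sup>2)" for Z
  proof -
    have fin: "finite Z" "Z \<noteq> {}" using Z(2) by (auto simp: card_ge_0_finite)
    have "Max Y - Min Y \<le> \<bar>Max Z - Min Z\<bar>" using Y(3)[of Z] Z by (simp add: F_def)
    then have "B \<le> real_of_int \<bar>Max Z - Min Z\<bar>" unfolding B_def of_int_le_iff .
    then show ?thesis using Max_in[OF fin] Min_in[OF fin] by blast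
  qed
  have sizes: "Suc (n * n\<^sup>2) \<le> card T" "1 \<le> n\<^sup>2" using T n by auto
  obtain X where X: "X \<subseteq> T" "card X = Suc n"
    "\<And>x x'. x \<in> X \<Longrightarrow> x' \<in> X \<Longrightarrow> x \<noteq> x' \<Longrightarrow> B \<le> real_of_int \<bar>x - x'\<bar>"
    using obtain_spaced_subset[OF finT sizes wide] by blast
  have l1: "l \<ge> 1"
  proof -
    have "B \<le> l"
      using diam[of "Max Y" "Min Y"] extreme T(1) unfolding B_eq by blast
    then show ?thesis using B1 by simp
  qed
  have Ll: "L powr (real n + gain n) \<le> l ^ n"
  proof -
    let ?e = "d - gain n - real n"
    have e: "?e \<ge> 0" using gain_le[OF n] by (simp add: d_eq)
    have "B ^ n \<le> (real n + 2) * \<delta> * real Q * l ^ n"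
      using X T B1 by (intro spacing[of X]) auto
    then have "2 * L powr d * B ^ n \<le> real Q * l ^ n"
      unfolding \<delta> using L0 by (simp add: field_simps)
    also have "\<dots> \<le> B powr (d - gain n) * l ^ n"
      using QB l1 by (intro mult_right_mono) (auto simp: d_eq)
    also have "B powr (d - gain n) = B powr ?e * B ^ n"
      using B1 by (simp add: powr_add[symmetric] flip: powr_realpow)
    finally have "2 * L powr d \<le> B powr ?e * l ^ n"
      using B1 by (simp add: mult_ac)
    also have "\<dots> \<le> L powr ?e * l ^ n"
      using BL B1 e l1 by (intro mult_right_mono powr_mono2) auto
    finally have *: "2 * L powr d \<le> L powr ?e * l ^ n" .
    \<comment> \<open>The power \<open>B powr ?e\<close> has a nonnegative exponent, so the worst case is \<open>B = L\<close>.\<close>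
    have "L powr ?e * L powr (real n + gain n) = L powr d"
      by (simp add: powr_add[symmetric])
    also have "\<dots> \<le> 2 * L powr d" by simp
    also note *
    finally show ?thesis using L0 by simp
  qed
  have E_le: "l powr \<theta> \<le> l / L"
  proof -
    have ng: "real n + gain n > 0" using n g0 by simp
    have "L = (L powr (real n + gain n)) powr (1 / (real n + gain n))"
      using L0 ng by (simp add: powr_powr)
    also have "\<dots> \<le> (l ^ n) powr (1 / (real n + gain n))"
      using Ll ng by (intro powr_mono2) auto
    also have "\<dots> = l powr (real n / (real n + gain n))"
      using l1 by (simp add: powr_powr flip: powr_realpow)
    finally have "L * l powr \<theta> \<le> l powr (real n / (real n + gain n)) * l powr \<theta>"
      by (intro mult_right_mono) auto
    also have "\<dots> = l powr (real n / (real n + gain n) + \<theta>)" by (simp add: powr_add)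
    also have "real n / (real n + gain n) + \<theta> = 1"
      using ng by (simp add: \<theta>_def flip: add_divide_distrib)
    finally show ?thesis using L0 l1 by (simp add: field_simps)
  qed
  define E where "E = real n ^ card (prime_factors Q)"
  have "E \<le> C * (l / L)"
  proof -
    have "real Q \<le> l ^ (Suc n choose 2)"
      using diam T X l1 by (intro denominator_le_diameter[OF dd Q(1), of X]) auto
    also have "\<dots> = l powr d" using l1 by (simp add: d_def powr_realpow)
    finally have "real Q powr (\<theta> / d) \<le> (l powr d) powr (\<theta> / d)"
      using g0 d n by (intro powr_mono2) (auto simp: \<theta>_def)
    also have "\<dots> = l powr \<theta>" using d by (simp add: powr_powr)
    also note E_le
    finally have "C * real Q powr (\<theta> / d) \<le> C * (l / L)" using C by (intro mult_left_mono) auto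
    then show ?thesis using omega(2)[OF Q(1)] by (simp add: E_def C_def)
  qed
  show ?thesis
  proof (cases "4 * real n * E \<le> real (card R)")
    case False
    then have "real (card R) \<le> 4 * real n * (C * (l / L))"
      using \<open>E \<le> C * (l / L)\<close> n by (smt (verit) mult_left_mono of_nat_0_le_iff)
    also have "\<dots> \<le> run_const n * (l / L)"
      using spread_pos[OF n] L0 l1 by (simp add: K algebra_simps)
    finally show ?thesis .
  next
    case True
    define b where "b = real (card R) * real Q powr (1 / real n) / spread n"
    obtain X where X: "X \<subseteq> R" "card X = Suc n"
      "\<And>x x'. x \<in> X \<Longrightarrow> x' \<in> X \<Longrightarrow> x \<noteq> x' \<Longrightarrow> b \<le> real_of_int \<bar>x - x'\<bar>"
      using obtain_spread_points[OF R Q(1) dd n True[unfolded E_def]] unfolding b_def by blast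
    have b: "b > 0"
      using cardR Q spread_pos[OF n] by (auto simp: b_def intro!: divide_pos_pos mult_pos_pos)
    have bn: "b ^ n = real (card R) ^ n * real Q / spread n ^ n"
      using Q n by (simp add: b_def power_divide power_mult_distrib powr_power)
    have "b ^ n \<le> (real n + 2) * \<delta> * real Q * l ^ n" using X b by (intro spacing) auto
    then have "real (card R) ^ n \<le> spread n ^ n * l ^ n / (2 * L powr d)"
      unfolding bn \<delta> using Q spread_pos[OF n] L0 by (simp add: field_simps)
    also have "\<dots> \<le> spread n ^ n * l ^ n / L ^ n"
    proof (intro divide_left_mono)
      have "L ^ n = L powr real n" using L0 by (simp add: powr_realpow)
      also have "\<dots> \<le> L powr d" using L1 gain_le[OF n] g0 by (intro powr_mono) (auto simp: d_eq)
      also have "\<dots> \<le> 2 * L powr d" by simp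
      finally show "L ^ n \<le> 2 * L powr d" .
    qed (use L0 l1 spread_pos[OF n] in auto)
    also have "\<dots> = (spread n * (l / L)) ^ n" by (simp add: power_mult_distrib power_divide)
    finally have "real (card R) \<le> spread n * (l / L)"
      using n L0 l1 spread_pos[OF n] by (simp add: power_mono_iff)
    also have "\<dots> \<le> run_const n * (l / L)"
      using n C L0 l1 by (intro mult_right_mono) (auto simp: K)
    finally show ?thesis .
  qed
qed

definition near_const :: "nat \<Rightarrow> real" where
  "near_const n = max (run_const n) (real (Suc (n * n\<^sup>2)))"

lemma near_const_ge_1: "near_const n \<ge> 1"
  unfolding near_const_def by (rule max.coboundedI2) simp

text \<open>
  The points are cut from left to right. If the successor of the first \<open>n * n\<^sup>2 + 1\<close> remaining points
  is more than \<open>L\<close> beyond the left end \<open>u\<close>, these points are removed. If not, they lie on one curve \<open>P\<close>,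
  and the run of points up to the first point off \<open>P\<close> is removed at the cost given by \<open>card_run_le\<close>.
  Each removal pays for itself with the length of the interval that it uses up. Only one run can fail
  to have a point after it, and \<open>F\<close> accounts for it.
\<close>

lemma card_near_curve_le:
  fixes f :: "real poly" and y :: "int \<Rightarrow> int" and S :: "int set" and u v :: int
  assumes n: "n \<ge> 1" and f: "degree f \<le> n" and "finite S"
    and L0: "L > 0" and L: "2 * (real n + 2) * \<delta> * L powr (real n * (real n + 1) / 2) = 1"
    and "\<And>x. x \<in> S \<Longrightarrow> \<bar>poly f (of_int x) - of_int (y x)\<bar> \<le> \<delta>"
    and "\<And>x. x \<in> S \<Longrightarrow> u \<le> x \<and> x \<le> v" and "u \<le> v"
    and "\<And>(P :: real poly) R. R \<subseteq> S \<Longrightarrow> degree P \<le> n \<Longrightarrow>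
      (\<And>x. x \<in> R \<Longrightarrow> poly P (of_int x) = of_int (y x)) \<Longrightarrow> real (card R) \<le> F"
    and F0: "F \<ge> 0"
  shows "real (card S) \<le> near_const n * (of_int (v - u) / L + 1) + F"
proof -
  define N where "N = Suc (n * n\<^sup>2)"
  have K: "near_const n \<ge> 1" "near_const n \<ge> real N" "near_const n \<ge> run_const n"
    using near_const_ge_1 by (auto simp: near_const_def N_def)
  show ?thesis
    using assms(3,6-9)
  proof (induction "card S" arbitrary: S u rule: less_induct)
    case less
    note fin = less.prems(1) and close = less.prems(2) and range = less.prems(3)
      and uv = less.prems(4) and onF = less.prems(5)
    \<comment> \<open>The length \<open>w - u\<close> pays for the removed points \<open>R\<close>; the others lie between \<open>w\<close> and \<open>v\<close>.\<close>
    have step: "real (card S) \<le> near_const n * (of_int (v - u) / L + 1) + F"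
      if R: "R \<subseteq> S" "R \<noteq> {}" and w: "w \<in> S" "\<And>x. x \<in> S - R \<Longrightarrow> w \<le> x"
        and R_le: "real (card R) \<le> near_const n * (of_int (w - u) / L)" for R w
    proof -
      have finR: "finite R" using R fin finite_subset by blast
      have "card (S - R) < card S"
        using R fin by (intro psubset_card_mono) auto
      moreover have "real (card R') \<le> F" if "R' \<subseteq> S - R" "degree P \<le> n"
        "\<And>x. x \<in> R' \<Longrightarrow> poly P (of_int x) = of_int (y x)" for P :: "real poly" and R'
        using onF[of R' P] that by blast
      ultimately have "real (card (S - R)) \<le> near_const n * (of_int (v - w) / L + 1) + F"
        using fin close range w by (intro less.hyps) auto
      moreover have "card S = card R + card (S - R)"
        using card_Diff_subset[OF finR R(1)] card_mono[OF fin R(1)] by simp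
      moreover have "near_const n * (of_int (w - u) / L) + near_const n * (of_int (v - w) / L + 1)
          = near_const n * (of_int (v - u) / L + 1)"
        by (simp add: field_simps add_divide_distrib diff_divide_distrib)
      ultimately show ?thesis using R_le by linarith
    qed
    show ?case
    proof (cases "card S \<le> N")
      case True
      have "0 \<le> near_const n * (of_int (v - u) / L)" using uv L0 K by simp
      then show ?thesis using True K(2) F0 by (simp add: distrib_left)
    next
      case False
      then obtain T where T: "T \<subseteq> S" "card T = N" "\<And>x z. x \<in> T \<Longrightarrow> z \<in> S - T \<Longrightarrow> x < z"
        using obtain_least_elements[OF fin, of N] by auto
      have finT: "finite T" using T fin finite_subset by blast
      have neT: "T \<noteq> {}" using T(2) by (auto simp: N_def)
      have ne: "S - T \<noteq> {}" using False T(1,2) by auto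
      define w where "w = Min (S - T)"
      have w: "w \<in> S - T" using Min_in[of "S - T"] ne fin by (simp add: w_def)
      have w_le: "w \<le> x" if "x \<in> S - T" for x using that fin by (simp add: w_def)
      show ?thesis
      proof (cases "L < of_int (w - u)")
        case True
        have "real (card T) \<le> near_const n * 1" using T(2) K(2) by simp
        also have "\<dots> \<le> near_const n * (of_int (w - u) / L)"
          using True L0 K(1) by (intro mult_left_mono) auto
        finally show ?thesis using w by (intro step[OF T(1) neT _ w_le]) auto
      next
        case False
        have TL: "real_of_int \<bar>x - x'\<bar> \<le> L" if "x \<in> insert w T" "x' \<in> insert w T" for x x'
        proof -
          have "u \<le> z \<and> z \<le> w" if "z \<in> insert w T" for z
            using that range[of z] T(1) T(3)[OF _ w] w by (auto intro: less_imp_le)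
          from this[OF that(1)] this[OF that(2)] have "\<bar>x - x'\<bar> \<le> w - u" by linarith
          then have "real_of_int \<bar>x - x'\<bar> \<le> of_int (w - u)" unfolding of_int_le_iff .
          then show ?thesis using False by linarith
        qed
        have "Suc n \<le> card T" using T(2) n by (simp add: N_def)
        then obtain X where X: "X \<subseteq> T" "card X = Suc n" by (rule obtain_subset_with_card_n)
        define P where "P = lagrange X (\<lambda>x. real_of_int (y x))"
        have P: "degree P \<le> n" unfolding P_def by (rule degree_lagrange[OF X(2)])
        have finX: "finite X" using X finT finite_subset by blast
        have onT: "poly P (of_int x) = of_int (y x)" if x: "x \<in> T" for x
        proof (cases "x \<in> X")
          case True
          then show ?thesis unfolding P_def by (rule poly_lagrange_node[OF finX])
        next
          case False
          show ?thesis
            unfolding P_def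
          proof (rule near_points_lie_on_lagrange[OF X(2) False f])
            show "\<bar>poly f (of_int z) - of_int (y z)\<bar> \<le> \<delta>" if "z \<in> insert x X" for z
              using close that x X(1) T(1) by blast
            show "real_of_int \<bar>z - z'\<bar> \<le> L" if "z \<in> insert x X" "z' \<in> insert x X" for z z'
              using TL that x X(1) by blast
            have "real (2 * (Suc n choose 2)) = real n * (real n + 1)"
              unfolding two_mult_choose_two by (simp add: algebra_simps)
            then have e2: "real (Suc n choose 2) = real n * (real n + 1) / 2" by simp
            have pw: "L ^ (Suc n choose 2) = L powr (real n * (real n + 1) / 2)"
              using powr_realpow[OF L0, of "Suc n choose 2", symmetric] unfolding e2 .
            have "2 * ((real n + 2) * \<delta> * L ^ (Suc n choose 2)) = 1"
              using L unfolding pw by (simp only: mult.assoc)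
            then show "(real n + 2) * \<delta> * L ^ (Suc n choose 2) < 1" by linarith
          qed
        qed
        show ?thesis
        proof (cases "\<forall>x\<in>S. poly P (of_int x) = of_int (y x)")
          case True
          then have "real (card S) \<le> F" using onF[of S P] P by blast
          moreover have "0 \<le> near_const n * (of_int (v - u) / L + 1)" using uv L0 K by simp
          ultimately show ?thesis by linarith
        next
          case False
          define Off where "Off = {x \<in> S. poly P (of_int x) \<noteq> of_int (y x)}"
          have Off: "finite Off" "Off \<noteq> {}" using False fin by (auto simp: Off_def)
          define w' where "w' = Min Off"
          have "w' \<in> Off" using Off Min_in by (auto simp: w'_def)
          then have w': "w' \<in> S" "poly P (of_int w') \<noteq> of_int (y w')" by (auto simp: Off_def)
          have w'_le: "w' \<le> x" if "x \<in> S" "poly P (of_int x) \<noteq> of_int (y x)" for x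
            using that Off by (auto simp: w'_def Off_def)
          define R where "R = {x \<in> S. x < w'}"
          have "w' \<in> S - T" using w' onT by blast
          then have TR: "T \<subseteq> R" using T by (auto simp: R_def)
          have "real (card R) \<le> run_const n * (of_int (w' - u) / L)"
          proof (rule card_run_le[OF n f P])
            show "finite R" using fin by (simp add: R_def)
            show "poly P (of_int x) = of_int (y x)" if "x \<in> R" for x
              using that w'_le[of x] by (auto simp: R_def)
            show "\<bar>poly f (of_int x) - of_int (y x)\<bar> \<le> \<delta>" if "x \<in> insert w' R" for x
              using that close w' by (auto simp: R_def)
            show "poly P (of_int w') \<noteq> of_int (y w')" by (rule w')
            show "real_of_int \<bar>x - x'\<bar> \<le> of_int (w' - u)" if "x \<in> insert w' R" "x' \<in> R" for x x'
            proof -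
              have "u \<le> x \<and> x \<le> w'" "u \<le> x' \<and> x' \<le> w'"
                using that range w' by (auto simp: R_def)
              then have "\<bar>x - x'\<bar> \<le> w' - u" by linarith
              then show ?thesis unfolding of_int_le_iff .
            qed
            show "T \<subseteq> R" "card T = Suc (n * n\<^sup>2)" using TR T(2) by (auto simp: N_def)
            show "real_of_int \<bar>x - x'\<bar> \<le> L" if "x \<in> T" "x' \<in> T" for x x'
              using TL that by blast
          qed (use L0 L in auto)
          also have "\<dots> \<le> near_const n * (of_int (w' - u) / L)"
            using K(3) range[OF w'(1)] L0 by (intro mult_right_mono) auto
          finally have "real (card R) \<le> near_const n * (of_int (w' - u) / L)" .
          moreover have "R \<noteq> {}" using TR neT by auto
          moreover have "w' \<le> x" if "x \<in> S - R" for x using that by (auto simp: R_def)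
          ultimately show ?thesis
            using w'(1) by (intro step[of R w']) (auto simp: R_def)
        qed
      qed
    qed
  qed
qed

section \<open>The last run and the leading coefficient\<close>

text \<open>
  Two different fractions differ by at least the inverse product of their denominators, and the reduced
  fraction \<open>r / s\<close> is not a fraction with the smaller denominator \<open>Q\<close>.
\<close>

lemma rational_approximation_gap:
  fixes c :: real
  assumes "real Q * c \<in> \<int>" "Q \<ge> 1" "1 \<le> s" "coprime r s" "int Q < s"
  shows "1 / (real Q * real_of_int s) \<le> \<bar>c - real_of_int r / real_of_int s\<bar>"
proof -
  obtain a where a: "real Q * c = of_int a" using assms(1) by (auto elim: Ints_cases)
  have "a * s \<noteq> r * int Q"
  proof
    assume "a * s = r * int Q"
    then have "s dvd r * int Q" by (metis dvd_triv_right)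
    then have "s dvd int Q" using assms(4) by (metis coprime_commute coprime_dvd_mult_right_iff)
    then show False using assms zdvd_imp_le[of s "int Q"] by simp
  qed
  then have "1 \<le> \<bar>a * s - r * int Q\<bar>" by linarith
  then have "1 \<le> real_of_int \<bar>a * s - r * int Q\<bar>" by linarith
  moreover have c: "c = of_int a / real Q" using a assms(2) by (simp add: field_simps)
  have "\<bar>c - real_of_int r / real_of_int s\<bar> = real_of_int \<bar>a * s - r * int Q\<bar> / (real Q * real_of_int s)"
    unfolding c using assms(2,3) by (simp add: divide_simps abs_divide)
  ultimately show ?thesis
    using assms(2,3) by (simp add: divide_right_mono)
qed

definition curve_const :: "nat \<Rightarrow> real \<Rightarrow> real" where
  "curve_const n \<epsilon> = 4 * real n * omega_const n (\<epsilon> / real (Suc n choose 2))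
      + 4 * real n ^ (n ^ n) + 2 * (real n + 1) * spread n"

text \<open>
  This is the only place where the rational approximation of the leading coefficient of \<open>f\<close> enters. If
  \<open>s \<le> 2 * Q\<close>, the density bound gives \<open>X / s powr (1 / n)\<close>. Otherwise the leading coefficient of \<open>P\<close> is a
  fraction with denominator dividing \<open>Q\<close>, so it is not \<open>r / s\<close> and stays away from the leading
  coefficient of \<open>f\<close> by about \<open>1 / (Q * s)\<close>. As \<open>P - f\<close> is at most \<open>\<delta>\<close> at points of spacing
  \<open>M * Q powr (1 / n)\<close>, its leading coefficient is at most of order \<open>\<delta> / (M ^ n * Q)\<close>. The denominators \<open>Q\<close>
  cancel, and \<open>M ^ n\<close> is at most of order \<open>\<delta> * s \<le> \<delta> * X ^ n\<close>.
\<close>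

lemma card_on_curve_le:
  fixes f P :: "real poly" and y :: "int \<Rightarrow> int" and \<delta> X \<epsilon> :: real and r s :: int
  assumes n: "n \<ge> 1" and \<epsilon>: "\<epsilon> > 0 \<or> n = 1 \<and> \<epsilon> \<ge> 0"
    and f: "degree f \<le> n" and P: "degree P \<le> n" and R: "finite R"
    and on: "\<And>x. x \<in> R \<Longrightarrow> poly P (of_int x) = of_int (y x)"
    and close: "\<And>x. x \<in> R \<Longrightarrow> \<bar>poly f (of_int x) - of_int (y x)\<bar> \<le> \<delta>"
    and diam: "\<And>x x'. x \<in> R \<Longrightarrow> x' \<in> R \<Longrightarrow> real_of_int \<bar>x - x'\<bar> \<le> X"
    and X: "X \<ge> 1" and \<delta>: "\<delta> \<ge> 0" and s: "1 \<le> s" "real_of_int s \<le> X ^ n"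
    and rs: "coprime r s" "\<bar>coeff f n - real_of_int r / real_of_int s\<bar> \<le> 1 / (real_of_int s)\<^sup>2"
  shows "real (card R) \<le> curve_const n \<epsilon> *
    (\<delta> powr (1 / real n) * X + X / real_of_int s powr (1 / real n) + X powr \<epsilon>)"
proof -
  define d where "d = real (Suc n choose 2)"
  have d: "d > 0" using n by (simp add: d_def)
  have "\<epsilon> / d > 0 \<or> n = 1 \<and> \<epsilon> / d \<ge> 0" using \<epsilon> d by auto
  note omega = omega_const_ge_1[OF n this] power_card_prime_factors_le[OF n this]
  define C where "C = omega_const n (\<epsilon> / d)"
  have C: "C \<ge> 1" using omega(1) by (simp add: C_def)
  define c where "c = real n ^ (n ^ n)"
  have c: "c > 0" using n by (simp add: c_def)
  define K where "K = curve_const n \<epsilon>"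
  have K: "K \<ge> 4 * real n * C" "K \<ge> 4 * c" "K \<ge> 2 * (real n + 1) * spread n"
    using c C n spread_pos[OF n] by (auto simp: K_def curve_const_def c_def C_def d_def)
  have "1 * 1 \<le> (4 * real n) * C" using n C by (intro mult_mono) auto
  then have K1: "K \<ge> 1" using K(1) by simp
  let ?t1 = "\<delta> powr (1 / real n) * X" and ?t2 = "X / real_of_int s powr (1 / real n)"
    and ?t3 = "X powr \<epsilon>"
  have t: "?t1 \<ge> 0" "?t2 \<ge> 0" "?t3 \<ge> 1"
    using X s \<epsilon> by (auto intro!: ge_one_powr_ge_zero)
  have goal: ?thesis
    if "real (card R) \<le> K * ?t1 \<or> real (card R) \<le> K * ?t2 \<or> real (card R) \<le> K * ?t3"
  proof -
    have "K \<ge> 0" "?t3 \<ge> 0" using K1 by auto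
    then have "K * ?t1 \<ge> 0" "K * ?t2 \<ge> 0" "K * ?t3 \<ge> 0"
      using mult_nonneg_nonneg t(1,2) by blast+
    then show ?thesis
      using that unfolding K_def[symmetric] by (auto simp: distrib_left)
  qed
  show ?thesis
  proof (cases "card R \<le> n")
    case True
    have "real n * 1 \<le> (4 * real n) * C" using C by (intro mult_mono) auto
    then have "real (card R) \<le> K * 1" using True K(1) by simp
    also have "\<dots> \<le> K * ?t3" using t(3) K1 by (intro mult_left_mono) auto
    finally show ?thesis using goal by blast
  next
    case False
    then have cardR: "Suc n \<le> card R" by simp
    obtain Q where Q: "Q \<ge> 1" "integral_poly (smult (of_nat Q) P)" and dd: "divides_differences n Q R"
      using denominator_exists[OF R cardR P] on by (metis Ints_of_int)
    define E where "E = real n ^ card (prime_factors Q)"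
    have "E \<le> C * ?t3"
    proof -
      obtain Y where Y: "Y \<subseteq> R" "card Y = Suc n" using cardR by (rule obtain_subset_with_card_n)
      have "real_of_int \<bar>x - x'\<bar> \<le> X" if "x \<in> Y" "x' \<in> Y" for x x' using diam Y that by blast
      then have "real Q \<le> X ^ (Suc n choose 2)"
        using X by (intro denominator_le_diameter[OF dd Q(1) Y]) auto
      also have "\<dots> = X powr d" using X by (simp add: d_def powr_realpow)
      finally have "real Q powr (\<epsilon> / d) \<le> (X powr d) powr (\<epsilon> / d)"
        using d \<epsilon> by (intro powr_mono2) auto
      also have "\<dots> = ?t3" using d by (simp add: powr_powr)
      finally have "C * real Q powr (\<epsilon> / d) \<le> C * ?t3" using C by (intro mult_left_mono) auto
      then show ?thesis using omega(2)[OF Q(1)] by (simp add: E_def C_def)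
    qed
    show ?thesis
    proof (cases "4 * real n * E \<le> real (card R)")
      case False
      then have "real (card R) \<le> 4 * real n * E" by simp
      also have "\<dots> \<le> 4 * real n * (C * ?t3)"
        using \<open>E \<le> C * ?t3\<close> by (intro mult_left_mono) auto
      also have "\<dots> = (4 * real n * C) * ?t3" by simp
      also have "\<dots> \<le> K * ?t3" using K(1) by (intro mult_right_mono) auto
      finally show ?thesis using goal by blast
    next
      case True
      have "real (card R) \<le> c * X * real Q powr (- (1 / real n)) + E"
        using card_le_density[OF R Q(1) dd n _ diam] X by (simp add: c_def E_def)
      moreover have "E * 4 \<le> E * (4 * real n)"
        using n by (intro mult_left_mono) (auto simp: E_def)
      then have "4 * E \<le> real (card R)" using True by (simp add: mult_ac)
      ultimately have M: "real (card R) \<le> 2 * (c * X * real Q powr (- (1 / real n)))"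
        by linarith
      show ?thesis
      proof (cases "s \<le> 2 * int Q")
        case True
        then have "real_of_int s \<le> 2 * real Q" by linarith
        have "real_of_int s powr (1 / real n) \<le> (2 * real Q) powr (1 / real n)"
          using \<open>real_of_int s \<le> 2 * real Q\<close> s n by (intro powr_mono2) auto
        also have "\<dots> = 2 powr (1 / real n) * real Q powr (1 / real n)"
          by (rule powr_mult) 
        also have "\<dots> \<le> 2 powr 1 * real Q powr (1 / real n)"
          using n by (intro mult_right_mono powr_mono) auto
        finally have "real Q powr (- (1 / real n)) \<le> 2 / real_of_int s powr (1 / real n)"
          using s Q by (simp add: powr_minus field_simps)
        then have "2 * (c * X * real Q powr (- (1 / real n)))
            \<le> 2 * (c * X * (2 / real_of_int s powr (1 / real n)))"
          using c X by (intro mult_left_mono) auto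
        also have "\<dots> = 4 * c * ?t2" by simp
        also have "\<dots> \<le> K * ?t2" using K(2) t(2) by (intro mult_right_mono) auto
        finally show ?thesis using M goal by linarith
      next
        case small: False
        define b where "b = real (card R) * real Q powr (1 / real n) / spread n"
        obtain Y where Y: "Y \<subseteq> R" "card Y = Suc n"
          "\<And>x x'. x \<in> Y \<Longrightarrow> x' \<in> Y \<Longrightarrow> x \<noteq> x' \<Longrightarrow> b \<le> real_of_int \<bar>x - x'\<bar>"
          using obtain_spread_points[OF R Q(1) dd n True[unfolded E_def]] unfolding b_def by blast
        have b: "b > 0"
          using cardR Q spread_pos[OF n] by (auto simp: b_def intro!: divide_pos_pos mult_pos_pos)
        have bn: "b ^ n = real (card R) ^ n * real Q / spread n ^ n"
          using Q n by (simp add: b_def power_divide power_mult_distrib powr_power)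
        have "\<bar>coeff (P - f) n\<bar> \<le> (real n + 1) * \<delta> / b ^ n"
        proof (rule spaced_interpolation_bounds(1)[OF Y(2) _ b Y(3)])
          show "degree (P - f) \<le> n" using P f by (rule degree_diff_le)
          show "\<bar>poly (P - f) (of_int x)\<bar> \<le> \<delta>" if "x \<in> Y" for x
            using on[of x] close[of x] Y(1) that by (auto simp: abs_minus_commute)
        qed
        moreover have "1 / (real Q * real_of_int s) \<le> \<bar>coeff P n - real_of_int r / real_of_int s\<bar>"
        proof (rule rational_approximation_gap[OF _ Q(1) s(1) rs(1)])
          show "real Q * coeff P n \<in> \<int>" using Q(2) by (auto simp: integral_poly_def)
          show "int Q < s" using small Q by linarith
        qed
        moreover have "1 / (real_of_int s)\<^sup>2 \<le> 1 / (2 * (real Q * real_of_int s))"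
        proof -
          have "2 * real Q \<le> real_of_int s" using small by linarith
          then have "2 * (real Q * real_of_int s) \<le> (real_of_int s)\<^sup>2"
            using s by (simp add: power2_eq_square mult_right_mono)
          then show ?thesis using Q s by (intro divide_left_mono) auto
        qed
        moreover have "\<bar>coeff P n - z\<bar> \<le> \<bar>coeff (P - f) n\<bar> + \<bar>coeff f n - z\<bar>" for z
          by simp
        ultimately have "1 / (real Q * real_of_int s)
            \<le> (real n + 1) * \<delta> / b ^ n + 1 / (2 * (real Q * real_of_int s))"
          using rs(2) by (meson add_mono order.trans)
        moreover define g where "g = 1 / (2 * (real Q * real_of_int s))"
        moreover have "1 / (real Q * real_of_int s) = g + g" by (simp add: g_def)
        ultimately have "1 / (2 * (real Q * real_of_int s)) \<le> (real n + 1) * \<delta> / b ^ n"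
          unfolding g_def[symmetric] by simp
        then have "b ^ n \<le> (real n + 1) * \<delta> * (2 * (real Q * real_of_int s))"
          using b Q s by (simp add: divide_simps)
        then have "real (card R) ^ n * real Q
            \<le> (real n + 1) * \<delta> * (2 * (real Q * real_of_int s)) * spread n ^ n"
          unfolding bn using spread_pos[OF n] by (subst (asm) pos_divide_le_eq) auto
        also have "\<dots> = spread n ^ n * (2 * (real n + 1) * \<delta> * real_of_int s) * real Q"
          by (simp only: mult_ac)
        finally have "real (card R) ^ n \<le> spread n ^ n * (2 * (real n + 1) * \<delta> * real_of_int s)"
          by (rule mult_right_le_imp_le) (use Q in auto)
        also have "\<dots> \<le> spread n ^ n * (2 * (real n + 1) * \<delta> * X ^ n)"
          using s(2) \<delta> spread_pos[OF n] by (intro mult_left_mono) auto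
        also have "\<dots> \<le> spread n ^ n * ((2 * (real n + 1)) ^ n * \<delta> * X ^ n)"
        proof -
          have "2 * (real n + 1) \<le> (2 * (real n + 1)) ^ n" using n by (intro self_le_power) auto
          then show ?thesis
            using \<delta> spread_pos[OF n] X by (intro mult_left_mono mult_right_mono) auto
        qed
        also have "\<dots> = (2 * (real n + 1) * spread n * ?t1) ^ n"
        proof -
          have "(\<delta> powr (1 / real n)) ^ n = \<delta>"
            using \<delta> n by (cases "\<delta> = 0") (auto simp: powr_power)
          then show ?thesis by (simp add: power_mult_distrib mult_ac)
        qed
        finally have "real (card R) \<le> 2 * (real n + 1) * spread n * ?t1"
          using n spread_pos[OF n] t(1) by (subst (asm) power_mono_iff) auto
        also have "\<dots> \<le> K * ?t1" using K(3) t(1) by (intro mult_right_mono) auto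
        finally show ?thesis using goal by blast
      qed
    qed
  qed
qed

lemma curve_const_nonneg:
  assumes n: "n \<ge> 1" and \<epsilon>: "\<epsilon> > 0 \<or> n = 1 \<and> \<epsilon> \<ge> 0"
  shows "curve_const n \<epsilon> \<ge> 0"
proof -
  have "\<epsilon> / real (Suc n choose 2) > 0 \<or> n = 1 \<and> \<epsilon> / real (Suc n choose 2) \<ge> 0"
    using n \<epsilon> by auto
  from omega_const_ge_1[OF n this] show ?thesis
    using spread_pos[OF n] by (simp add: curve_const_def)
qed

section \<open>Lattice points near the curve\<close>

definition near_curve_const :: "nat \<Rightarrow> real \<Rightarrow> real" where
  "near_curve_const n \<epsilon> = 2 * (real n + 2) * near_const n + curve_const n \<epsilon>"

lemma near_curve_const_pos:
  assumes n: "n \<ge> 1" and \<epsilon>: "\<epsilon> > 0 \<or> n = 1 \<and> \<epsilon> \<ge> 0"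
  shows "near_curve_const n \<epsilon> > 0"
  using n near_const_ge_1[of n] curve_const_nonneg[OF n \<epsilon>]
  unfolding near_curve_const_def by (intro add_pos_nonneg mult_pos_pos) auto

lemma card_near_interval_le:
  fixes f :: "real poly" and y :: "int \<Rightarrow> int" and \<delta> X \<epsilon> :: real and r s :: int
  assumes n: "n \<ge> 1" and \<epsilon>: "\<epsilon> > 0 \<or> n = 1 \<and> \<epsilon> \<ge> 0"
    and f: "degree f \<le> n" and fin: "finite S"
    and close: "\<And>x. x \<in> S \<Longrightarrow> \<bar>poly f (of_int x) - of_int (y x)\<bar> \<le> \<delta>"
    and range: "\<And>x. x \<in> S \<Longrightarrow> X \<le> of_int x \<and> of_int x \<le> 2 * X"
    and \<delta>: "0 < \<delta>" "\<delta> \<le> 1" and X: "X \<ge> 1" and s: "1 \<le> s" "real_of_int s \<le> X ^ n"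
    and rs: "coprime r s" "\<bar>coeff f n - real_of_int r / real_of_int s\<bar> \<le> 1 / (real_of_int s)\<^sup>2"
  shows "real (card S) \<le> near_curve_const n \<epsilon> * (\<delta> powr (2 / (real n * (real n + 1))) * X
        + X / real_of_int s powr (1 / real n) + X powr \<epsilon>)"
proof -
  define K1 where "K1 = near_const n"
  define K2 where "K2 = curve_const n \<epsilon>"
  have K1: "K1 \<ge> 1" and K2: "K2 \<ge> 0"
    using near_const_ge_1 curve_const_nonneg[OF n \<epsilon>] by (auto simp: K1_def K2_def)
  define a where "a = 2 * (real n + 2)"
  define K where "K = a * K1 + K2"
  have a: "a \<ge> 1" by (simp add: a_def)
  have Kpos: "K > 0" using K1 K2 a by (simp add: K_def add_pos_nonneg)
  define e where "e = 2 / (real n * (real n + 1))"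
  have e: "0 < e" "e \<le> 1 / real n" "e \<le> 1"
  proof -
    show "0 < e" using n by (simp add: e_def)
    have "2 / (real n * (real n + 1)) \<le> 2 / (real n * 2)"
      using n by (intro divide_left_mono mult_left_mono) auto
    then show "e \<le> 1 / real n" by (simp add: e_def)
    also have "\<dots> \<le> 1" using n by simp
    finally show "e \<le> 1" .
  qed
  \<comment> \<open>The largest length for which \<open>near_points_lie_on_lagrange\<close> applies, up to a factor.\<close>
  define L where "L = (a * \<delta>) powr (- e)"
  have a\<delta>: "a * \<delta> > 0" using a \<delta> by simp
  have L0: "L > 0" unfolding L_def using a\<delta> by (subst powr_gt_zero) linarith
  have L: "2 * (real n + 2) * \<delta> * L powr (real n * (real n + 1) / 2) = 1"
  proof -
    have "- e * (real n * (real n + 1) / 2) = - 1" using n by (simp add: e_def)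
    then have "L powr (real n * (real n + 1) / 2) = (a * \<delta>) powr (- 1)"
      by (simp only: L_def powr_powr)
    then show ?thesis
      unfolding a_def[symmetric] using a \<delta> by (simp add: powr_minus field_simps)
  qed
  have L_inv: "1 / L \<le> a * \<delta> powr e"
  proof -
    have "1 / L = a powr e * \<delta> powr e"
      using a \<delta> by (simp add: L_def powr_minus powr_mult divide_inverse)
    also have "a powr e \<le> a powr 1" using a e by (intro powr_mono) auto
    finally show ?thesis using a by (simp add: mult_right_mono)
  qed
  let ?t1 = "\<delta> powr e * X" and ?t2 = "X / real_of_int s powr (1 / real n)" and ?t3 = "X powr \<epsilon>"
  have t: "?t1 \<ge> 0" "?t2 \<ge> 0" "?t3 \<ge> 1"
    using X s \<epsilon> by (auto intro!: ge_one_powr_ge_zero)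
  define F where "F = K2 * (?t1 + ?t2 + ?t3)"
  have F: "real (card R) \<le> F" if R: "R \<subseteq> S" and P: "degree P \<le> n"
    "\<And>x. x \<in> R \<Longrightarrow> poly P (of_int x) = of_int (y x)" for P :: "real poly" and R
  proof -
    have "real (card R) \<le> K2 * (\<delta> powr (1 / real n) * X + ?t2 + ?t3)"
      unfolding K2_def
    proof (rule card_on_curve_le[OF n \<epsilon> f P(1) finite_subset[OF R fin] P(2)])
      show "\<bar>poly f (of_int x) - of_int (y x)\<bar> \<le> \<delta>" if "x \<in> R" for x using close R that by blast
      show "real_of_int \<bar>x - x'\<bar> \<le> X" if "x \<in> R" "x' \<in> R" for x x'
      proof -
        have "x \<in> S" "x' \<in> S" using R that by auto
        from range[OF this(1)] range[OF this(2)] show ?thesis by linarith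
      qed
    qed (use X \<delta> s rs in auto)
    also have "\<dots> \<le> F"
      unfolding F_def using \<delta> e X K2
      by (intro mult_left_mono add_right_mono mult_right_mono powr_mono') auto
    finally show ?thesis .
  qed
  have "real (card S) \<le> K1 * (of_int (\<lfloor>2 * X\<rfloor> - \<lceil>X\<rceil>) / L + 1) + F" if ne: "S \<noteq> {}"
    unfolding K1_def
  proof (rule card_near_curve_le[OF n f fin L0 L close _ _ F])
    show *: "\<lceil>X\<rceil> \<le> x \<and> x \<le> \<lfloor>2 * X\<rfloor>" if "x \<in> S" for x
      using range[OF that] by (simp add: ceiling_le_iff le_floor_iff)
    obtain x where "x \<in> S" using ne by blast
    from *[OF this] show "\<lceil>X\<rceil> \<le> \<lfloor>2 * X\<rfloor>" by linarith
    show "0 \<le> F" using F[of "{}" 0] by simp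
  qed
  moreover have "K1 * (of_int (\<lfloor>2 * X\<rfloor> - \<lceil>X\<rceil>) / L + 1) \<le> a * K1 * (?t1 + ?t2 + ?t3)"
  proof -
    have "real_of_int (\<lfloor>2 * X\<rfloor> - \<lceil>X\<rceil>) \<le> X" by linarith
    then have "real_of_int (\<lfloor>2 * X\<rfloor> - \<lceil>X\<rceil>) / L \<le> X * (1 / L)"
      using L0 by (simp add: divide_right_mono)
    also have "\<dots> \<le> X * (a * \<delta> powr e)" using L_inv X by (intro mult_left_mono) auto
    finally have "real_of_int (\<lfloor>2 * X\<rfloor> - \<lceil>X\<rceil>) / L \<le> a * ?t1" by (simp add: mult_ac)
    moreover have "1 * 1 \<le> a * ?t3" using a t(3) by (intro mult_mono) auto
    moreover have "0 \<le> a * ?t2" using a t(2) by (intro mult_nonneg_nonneg) auto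
    ultimately have "of_int (\<lfloor>2 * X\<rfloor> - \<lceil>X\<rceil>) / L + 1 \<le> a * (?t1 + ?t2 + ?t3)"
      unfolding distrib_left by linarith
    then have "K1 * (of_int (\<lfloor>2 * X\<rfloor> - \<lceil>X\<rceil>) / L + 1) \<le> K1 * (a * (?t1 + ?t2 + ?t3))"
      using K1 by (intro mult_left_mono) auto
    then show ?thesis by (simp only: mult_ac)
  qed
  moreover have "K * (?t1 + ?t2 + ?t3) = a * K1 * (?t1 + ?t2 + ?t3) + F"
    by (simp only: K_def F_def distrib_right)
  moreover have "0 \<le> K * (?t1 + ?t2 + ?t3)" using Kpos t by simp
  ultimately have "real (card S) \<le> K * (?t1 + ?t2 + ?t3)"
    by (cases "S = {}") auto
  then show ?thesis
    by (simp only: e_def K_def K1_def K2_def a_def near_curve_const_def)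
qed

text \<open>
  Over each abscissa there is at most one lattice point, because \<open>2 * \<delta> < 1\<close>.
\<close>

lemma lattice_count_le_card:
  assumes "0 \<le> \<delta>" "\<delta> \<le> 1 / 4"
  obtains S y where "finite S" "\<And>x. x \<in> S \<Longrightarrow> \<bar>poly f (of_int x) - of_int (y x)\<bar> \<le> \<delta>"
    "\<And>x. x \<in> S \<Longrightarrow> X \<le> of_int x \<and> of_int x \<le> 2 * X" "lattice_count f \<delta> X \<le> card S"
proof -
  define A where "A = curve_nbhd f \<delta> X \<inter> \<int> \<times> \<int>"
  define S where "S = (\<lambda>q. \<lfloor>fst q\<rfloor>) ` A"
  have "\<exists>y. \<bar>poly f (of_int x) - of_int y\<bar> \<le> \<delta>" if "x \<in> S" for x :: int
    using that by (force simp: S_def A_def curve_nbhd_def abs_minus_commute elim!: Ints_cases)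
  then obtain y where y: "\<And>x. x \<in> S \<Longrightarrow> \<bar>poly f (of_int x) - of_int (y x)\<bar> \<le> \<delta>" by metis
  have "inj_on (\<lambda>q. \<lfloor>fst q\<rfloor>) A"
  proof (rule inj_onI)
    fix p q assume "p \<in> A" "q \<in> A" and eq: "\<lfloor>fst p\<rfloor> = \<lfloor>fst q\<rfloor>"
    then obtain a b a' b' where p: "p = (of_int a, of_int b)" and q: "q = (of_int a', of_int b')"
      by (auto simp: A_def elim!: Ints_cases)
    have a: "a = a'" using eq p q by simp
    have "\<bar>real_of_int b - poly f (of_int a)\<bar> \<le> \<delta>" "\<bar>real_of_int b' - poly f (of_int a)\<bar> \<le> \<delta>"
      using \<open>p \<in> A\<close> \<open>q \<in> A\<close> p q a by (auto simp: A_def curve_nbhd_def)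
    then have "\<bar>real_of_int b - real_of_int b'\<bar> < 1" using assms by linarith
    then have "b = b'" by linarith
    then show "p = q" using p q a by simp
  qed
  then have "card S = card A" unfolding S_def by (rule card_image)
  then have "lattice_count f \<delta> X \<le> card S" by (simp add: lattice_count_def A_def)
  moreover have "finite S" unfolding S_def A_def by (intro finite_imageI finite_curve_nbhd_lattice)
  moreover have "X \<le> of_int x \<and> of_int x \<le> 2 * X" if "x \<in> S" for x
    using that by (auto simp: S_def A_def curve_nbhd_def elim!: Ints_cases)
  ultimately show thesis using that y by blast
qed

lemma lattice_count_le:
  fixes f :: "real poly" and \<delta> X \<epsilon> :: real and r s :: int
  assumes n: "n \<ge> 1" and \<epsilon>: "\<epsilon> > 0 \<or> n = 1 \<and> \<epsilon> \<ge> 0"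
    and f: "degree f = n" and \<delta>: "0 \<le> \<delta>" "\<delta> \<le> 1 / 4" and X: "X \<ge> 1"
    and s: "1 \<le> s" "real_of_int s \<le> X ^ n"
    and rs: "coprime r s" "\<bar>coeff f n - real_of_int r / real_of_int s\<bar> \<le> 1 / (real_of_int s)\<^sup>2"
  shows "real (lattice_count f \<delta> X) \<le> 2 * near_curve_const n \<epsilon> *
    (\<delta> powr (2 / (real n * (real n + 1))) * X + X / real_of_int s powr (1 / real n) + X powr \<epsilon>)"
proof -
  define K where "K = near_curve_const n \<epsilon>"
  have K: "K > 0" using near_curve_const_pos[OF n \<epsilon>] by (simp add: K_def)
  define e where "e = 2 / (real n * (real n + 1))"
  have e: "e > 0" using n by (simp add: e_def)
  \<comment> \<open>For \<open>\<delta> = 0\<close> the length \<open>L\<close> would be infinite. The lower bound imposed on \<open>\<delta>\<close> changes the first term by at most 1.\<close>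
  define \<delta>' where "\<delta>' = max \<delta> (X powr (- (1 / e)))"
  have \<delta>': "0 < \<delta>'" "\<delta> \<le> \<delta>'" using X by (auto simp: \<delta>'_def less_max_iff_disj)
  have "X powr (- (1 / e)) \<le> X powr 0" using X e by (intro powr_mono) auto
  then have "\<delta>' \<le> 1" using X \<delta> by (auto simp: \<delta>'_def)
  obtain S y where S: "finite S" "\<And>x. x \<in> S \<Longrightarrow> \<bar>poly f (of_int x) - of_int (y x)\<bar> \<le> \<delta>"
    "\<And>x. x \<in> S \<Longrightarrow> X \<le> of_int x \<and> of_int x \<le> 2 * X" "lattice_count f \<delta> X \<le> card S"
    using lattice_count_le_card[OF \<delta>] by metis
  let ?t2 = "X / real_of_int s powr (1 / real n)" and ?t3 = "X powr \<epsilon>"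
  have "real (lattice_count f \<delta> X) \<le> real (card S)" using S(4) by simp
  also have "\<dots> \<le> K * (\<delta>' powr e * X + ?t2 + ?t3)"
    unfolding e_def K_def
  proof (rule card_near_interval_le[OF n \<epsilon> _ S(1) _ S(3)])
    show "\<bar>poly f (of_int x) - of_int (y x)\<bar> \<le> \<delta>'" if "x \<in> S" for x
      using S(2)[OF that] \<delta>'(2) by linarith
  qed (use f \<delta>' \<open>\<delta>' \<le> 1\<close> X s rs in auto)
  also have "\<dots> \<le> K * (2 * (\<delta> powr e * X + ?t2 + ?t3))"
  proof (intro mult_left_mono)
    have "\<delta>' powr e * X \<le> \<delta> powr e * X + 1"
    proof (cases "X powr (- (1 / e)) \<le> \<delta>")
      case False
      then have "\<delta>' powr e = X powr (- 1)" using e by (simp add: \<delta>'_def powr_powr)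
      then show ?thesis using X by (simp add: powr_minus)
    qed (use X in \<open>simp add: \<delta>'_def\<close>)
    moreover have "1 \<le> ?t3" using X \<epsilon> by (auto intro!: ge_one_powr_ge_zero)
    moreover have "0 \<le> \<delta> powr e * X" "0 \<le> ?t2" using X by auto
    moreover have "p' + t2 + t3 \<le> 2 * (p + t2 + t3)"
      if "p' \<le> p + 1" "1 \<le> t3" "0 \<le> p" "0 \<le> t2" for p p' t2 t3 :: real
      using that unfolding distrib_left by linarith
    ultimately show "\<delta>' powr e * X + ?t2 + ?t3 \<le> 2 * (\<delta> powr e * X + ?t2 + ?t3)"
      by blast
  qed (use K in auto)
  finally show ?thesis
    by (simp only: e_def K_def mult_ac)
qed

theorem corollary1p1:
  "(\<forall>n::nat. \<forall>\<epsilon>::real. n \<ge> 1 \<longrightarrow> \<epsilon> > 0 \<longrightarrow>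
      (\<exists>C::real. C > 0 \<and>
        (\<forall>(f::real poly) (\<delta>::real) (X::real) (r::int) (s::int).
           degree f = n \<longrightarrow> 0 \<le> \<delta> \<longrightarrow> \<delta> \<le> 1 / 4 \<longrightarrow> X \<ge> 2 \<longrightarrow>
           1 \<le> s \<longrightarrow> real_of_int s \<le> X ^ n \<longrightarrow> coprime r s \<longrightarrow>
           \<bar>coeff f n - real_of_int r / real_of_int s\<bar> \<le> 1 / (real_of_int s)\<^sup>2 \<longrightarrow>
           real (lattice_count f \<delta> X)
             \<le> C * (\<delta> powr (2 / (real n * (real n + 1))) * X
                    + X / real_of_int s powr (1 / real n) + X powr \<epsilon>))))
   \<and> (\<exists>C'::real. C' > 0 \<and>
        (\<forall>(f::real poly) (\<delta>::real) (X::real) (r::int) (s::int).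
           degree f = 1 \<longrightarrow> 0 \<le> \<delta> \<longrightarrow> \<delta> \<le> 1 / 4 \<longrightarrow> X \<ge> 2 \<longrightarrow>
           1 \<le> s \<longrightarrow> real_of_int s \<le> X \<longrightarrow> coprime r s \<longrightarrow>
           \<bar>coeff f 1 - real_of_int r / real_of_int s\<bar> \<le> 1 / (real_of_int s)\<^sup>2 \<longrightarrow>
           real (lattice_count f \<delta> X) \<le> C' * (\<delta> * X + X / real_of_int s + 1)))"
proof (intro conjI allI impI)
  fix n :: nat and \<epsilon> :: real
  assume n: "n \<ge> 1" and \<epsilon>: "\<epsilon> > 0"
  have "2 * near_curve_const n \<epsilon> > 0" using near_curve_const_pos[OF n] \<epsilon> by simp
  then show "\<exists>C::real. C > 0 \<and>
        (\<forall>(f::real poly) (\<delta>::real) (X::real) (r::int) (s::int).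
           degree f = n \<longrightarrow> 0 \<le> \<delta> \<longrightarrow> \<delta> \<le> 1 / 4 \<longrightarrow> X \<ge> 2 \<longrightarrow>
           1 \<le> s \<longrightarrow> real_of_int s \<le> X ^ n \<longrightarrow> coprime r s \<longrightarrow>
           \<bar>coeff f n - real_of_int r / real_of_int s\<bar> \<le> 1 / (real_of_int s)\<^sup>2 \<longrightarrow>
           real (lattice_count f \<delta> X)
             \<le> C * (\<delta> powr (2 / (real n * (real n + 1))) * X
                    + X / real_of_int s powr (1 / real n) + X powr \<epsilon>))"
    using n \<epsilon> by (intro exI[of _ "2 * near_curve_const n \<epsilon>"] conjI allI impI lattice_count_le) auto
next
  have "2 * near_curve_const 1 0 > 0" using near_curve_const_pos[of 1 0] by simp
  moreover have "real (lattice_count f \<delta> X)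
      \<le> 2 * near_curve_const 1 0 * (\<delta> * X + X / real_of_int s + 1)"
    if "degree f = 1" "0 \<le> \<delta>" "\<delta> \<le> 1 / 4" "X \<ge> 2" "1 \<le> s" "real_of_int s \<le> X" "coprime r s"
      "\<bar>coeff f 1 - real_of_int r / real_of_int s\<bar> \<le> 1 / (real_of_int s)\<^sup>2"
    for f :: "real poly" and \<delta> X :: real and r s :: int
    using lattice_count_le[of 1 0 f \<delta> X s r] that by simp
  ultimately show "\<exists>C'::real. C' > 0 \<and>
        (\<forall>(f::real poly) (\<delta>::real) (X::real) (r::int) (s::int).
           degree f = 1 \<longrightarrow> 0 \<le> \<delta> \<longrightarrow> \<delta> \<le> 1 / 4 \<longrightarrow> X \<ge> 2 \<longrightarrow>
           1 \<le> s \<longrightarrow> real_of_int s \<le> X \<longrightarrow> coprime r s \<longrightarrow>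
           \<bar>coeff f 1 - real_of_int r / real_of_int s\<bar> \<le> 1 / (real_of_int s)\<^sup>2 \<longrightarrow>
           real (lattice_count f \<delta> X) \<le> C' * (\<delta> * X + X / real_of_int s + 1))"
    by blast
qed

end
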